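(* Let $A$ be a real vector bundle over a smooth manifold $M$ carrying a derivative Lie algebra structure $(\Gamma(A),[\cdot,\cdot])$ with symbol $\lambda:\Gamma(A)\to\Gamma(TM)$, $a\mapsto\lambda_a$, and squiggle $\Lambda^\sharp$. Then the following identities hold for all $a,b,c\in\Gamma(A)$ and all $f,g,h\in C^\infty(M)$: 1. $\lambda_{f\cdot a}=f\cdot\lambda_a+\Lambda^\sharp(df\otimes a)$; 2. $\Lambda^\sharp(df\otimes a)[g]\cdot b=-\Lambda^\sharp(dg\otimes b)[f]\cdot a$; 3. $\lambda_{[a,b]}=[\lambda_a,\lambda_b]$; 4. $[\lambda_a,\Lambda^\sharp(df\otimes b)]=\Lambda^\sharp\big(d(\lambda_a[f])\otimes b+df\otimes[a,b]\big)$; 5. $\Lambda^\sharp(df\otimes a)\big[\Lambda^\sharp(dg\otimes b)[h]\big]\cdot c+\Lambda^\sharp(dg\otimes b)\big[\Lambda^\sharp(dh\otimes c)[f]\big]\cdot a+\Lambda^\sharp(dh\otimes c)\big[\Lambda^\sharp(df\otimes a)[g]\big]\cdot b=\lambda_b[f]\,\Lambda^\sharp(dg\otimes a)[h]\cdot c+\lambda_c[g]\,\Lambda^\sharp(dh\otimes b)[f]\cdot a+\lambda_a[h]\,\Lambda^\sharp(df\otimes c)[g]\cdot b$.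
   Context: For vector bundles $A,B$ over $M$, a differential operator (of order $\le 1$) is an $\mathbb{R}$-linear map $\Delta:\Gamma(A)\to\Gamma(B)$ such that $[[\Delta,f],g]=0$ for all $f,g\in C^\infty(M)$ (commutators with multiplication operators); equivalently, there is a unique $\sigma_\Delta\in\Gamma(TM\otimes A^*\otimes B)$, its symbol, with $\Delta(f\cdot a)=f\cdot\Delta(a)+\sigma_\Delta(df,a)$. A derivative Lie algebra structure on $A$ is an $\mathbb{R}$-bilinear Lie bracket $[\cdot,\cdot]$ on $\Gamma(A)$ acting as a derivation in each argument, i.e. satisfying $[a,f\cdot b]=f\cdot[a,b]+\lambda_a[f]\cdot b$ for all $a,b\in\Gamma(A)$, $f\in C^\infty(M)$, where $\lambda:\Gamma(A)\to\Gamma(TM)$ is a differential operator of order $\le 1$. The map $\lambda$ is called the symbol of the derivative Lie algebra, and the symbol $\Lambda^\sharp:=\sigma_\lambda\in\Gamma(TM\otimes A^*\otimes TM)$ of $\lambda$ as a differential operator, regarded as a $C^\infty(M)$-linear map $\Gamma(T^*M\otimes A)\to\Gamma(TM)$, is called its squiggle. For a vector field $X$ and a function $f$, $X[f]$ denotes the directional derivative.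
   Formalization: Identity 5 is proved with a minus sign before its whole right-hand side, since as printed it fails: for the Poisson bracket on R² with {x,y}=1, a=c=1, f=g=x, b=h=y, the left side is 1 and the right side is −1. *)

theory Defs
  imports "HOL-Analysis.Analysis" "HOL-Library.Function_Algebras"
begin

(* Sections, functions on the manifold and tangent vectors are all HOL functions; they are added
   and scaled pointwise. *)

instantiation "fun" :: (type, real_vector) real_vector
begin

definition scaleR_fun :: "real \<Rightarrow> ('a \<Rightarrow> 'b) \<Rightarrow> 'a \<Rightarrow> 'b"
  where "scaleR_fun r f = (\<lambda>x. r *\<^sub>R f x)"

instance
  by standard (simp_all add: scaleR_fun_def fun_eq_iff scaleR_add_right scaleR_add_left)

end

lemma scaleR_fun_apply [simp]: "(r *\<^sub>R f) x = r *\<^sub>R f x"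
  by (simp add: scaleR_fun_def)


section \<open>Smooth functions on open subsets of Euclidean space\<close>

(* R^n is the library's Euclidean_space n, i.e. the sequences vanishing from index n on, so that
   dimension 0 is included and the dimension is an ordinary natural number. *)

definition partial_deriv :: "nat \<Rightarrow> ((nat \<Rightarrow> real) \<Rightarrow> real) \<Rightarrow> (nat \<Rightarrow> real) \<Rightarrow> real"
  where "partial_deriv i F p = deriv (\<lambda>t. F (p(i := t))) (p i)"

primrec Ck_on :: "nat \<Rightarrow> nat \<Rightarrow> (nat \<Rightarrow> real) set \<Rightarrow> ((nat \<Rightarrow> real) \<Rightarrow> real) \<Rightarrow> bool"
  where
    "Ck_on n 0 W F \<longleftrightarrow> continuous_map (subtopology (Euclidean_space n) W) euclideanreal F"
  | "Ck_on n (Suc k) W F \<longleftrightarrow>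
       continuous_map (subtopology (Euclidean_space n) W) euclideanreal F \<and>
       (\<forall>i<n. (\<forall>p\<in>W. (\<lambda>t. F (p(i := t))) field_differentiable at (p i)) \<and>
              Ck_on n k W (partial_deriv i F))"

(* used for open W only *)
definition smooth_on :: "nat \<Rightarrow> (nat \<Rightarrow> real) set \<Rightarrow> ((nat \<Rightarrow> real) \<Rightarrow> real) \<Rightarrow> bool"
  where "smooth_on n W F \<longleftrightarrow> (\<forall>k. Ck_on n k W F)"


section \<open>Smooth manifolds\<close>

(* The underlying space of the manifold is the whole type 'm; the sort constraints
   t2_space and second_countable_topology are imposed where a manifold is fixed.
   The smooth structure is given by an atlas, not necessarily maximal. *)

record 'm smooth_structure =
  mdim :: nat
  atlas :: "('m set \<times> ('m \<Rightarrow> nat \<Rightarrow> real)) set"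

definition smooth_manifold :: "('m::{t2_space,second_countable_topology}) smooth_structure \<Rightarrow> bool"
  where "smooth_manifold M \<longleftrightarrow>
    (\<Union>(U, \<phi>)\<in>atlas M. U) = UNIV \<and>
    (\<forall>(U, \<phi>)\<in>atlas M.
       open U \<and> openin (Euclidean_space (mdim M)) (\<phi> ` U) \<and>
       homeomorphic_map (top_of_set U) (subtopology (Euclidean_space (mdim M)) (\<phi> ` U)) \<phi>) \<and>
    (\<forall>(U, \<phi>)\<in>atlas M. \<forall>(V, \<psi>)\<in>atlas M. \<forall>i<mdim M.
       smooth_on (mdim M) (\<phi> ` (U \<inter> V)) (\<lambda>p. \<psi> (inv_into U \<phi> p) i))"

(* smooth functions on the open set S; values outside S are irrelevant *)
definition smooth_funs_on :: "'m smooth_structure \<Rightarrow> 'm set \<Rightarrow> ('m \<Rightarrow> real) set"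
  where "smooth_funs_on M S =
    {f. \<forall>(U, \<phi>)\<in>atlas M. smooth_on (mdim M) (\<phi> ` (U \<inter> S)) (f \<circ> inv_into U \<phi>)}"

abbreviation smooth_funs :: "'m smooth_structure \<Rightarrow> ('m \<Rightarrow> real) set"
  where "smooth_funs M \<equiv> smooth_funs_on M UNIV"


section \<open>Vector bundles and their sections\<close>

(* The fibre over x is a linear subspace of an arbitrary ambient real vector space 'v; the total
   space is the disjoint union of the fibres. Every family of real vector spaces has this form,
   for instance inside its direct sum. The bundle structure is a cover by local trivialisations,
   given by local frames e 0, ..., e (rank - 1) over open sets U with smooth transition
   functions. *)

record ('m, 'v) vbundle =
  vrank :: nat
  fib :: "'m \<Rightarrow> 'v set"
  frames :: "('m set \<times> (nat \<Rightarrow> 'm \<Rightarrow> 'v)) set"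

definition smooth_comb ::
  "'m smooth_structure \<Rightarrow> nat \<Rightarrow> 'm set \<Rightarrow> (nat \<Rightarrow> 'm \<Rightarrow> 'v::real_vector) \<Rightarrow> ('m \<Rightarrow> 'v) \<Rightarrow> bool"
  where "smooth_comb M k W e s \<longleftrightarrow>
    (\<exists>c. (\<forall>i<k. c i \<in> smooth_funs_on M W) \<and> (\<forall>x\<in>W. s x = (\<Sum>i<k. c i x *\<^sub>R e i x)))"

definition vector_bundle ::
  "('m::topological_space) smooth_structure \<Rightarrow> ('m, 'v::real_vector) vbundle \<Rightarrow> bool"
  where "vector_bundle M A \<longleftrightarrow>
    (\<forall>x. subspace (fib A x)) \<and>
    (\<Union>(U, e)\<in>frames A. U) = UNIV \<and>
    (\<forall>(U, e)\<in>frames A. open U \<and>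
       (\<forall>x\<in>U. inj_on (\<lambda>i. e i x) {..<vrank A} \<and> independent ((\<lambda>i. e i x) ` {..<vrank A}) \<and>
              span ((\<lambda>i. e i x) ` {..<vrank A}) = fib A x)) \<and>
    (\<forall>(U, e)\<in>frames A. \<forall>(V, e')\<in>frames A. \<forall>j<vrank A. smooth_comb M (vrank A) (U \<inter> V) e (e' j))"

definition sections ::
  "'m smooth_structure \<Rightarrow> ('m, 'v::real_vector) vbundle \<Rightarrow> ('m \<Rightarrow> 'v) set"  ("\<Gamma>")
  where "\<Gamma> M A =
    {s. (\<forall>x. s x \<in> fib A x) \<and> (\<forall>(U, e)\<in>frames A. smooth_comb M (vrank A) U e s)}"

definition fun_scale :: "('m \<Rightarrow> real) \<Rightarrow> ('m \<Rightarrow> 'v::real_vector) \<Rightarrow> 'm \<Rightarrow> 'v"  (infixr "\<cdot>" 75)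
  where "f \<cdot> s = (\<lambda>x. f x *\<^sub>R s x)"


section \<open>The tangent bundle\<close>

(* Tangent vectors are the point derivations of the algebra of smooth functions. They are total
   HOL functions, hence set to 0 on non-smooth arguments to make equality extensional. *)

type_synonym 'm tvec = "('m \<Rightarrow> real) \<Rightarrow> real"

definition tangent_space :: "'m smooth_structure \<Rightarrow> 'm \<Rightarrow> 'm tvec set"
  where "tangent_space M x =
    {v. (\<forall>f\<in>smooth_funs M. \<forall>g\<in>smooth_funs M. v (f + g) = v f + v g) \<and>
        (\<forall>f\<in>smooth_funs M. \<forall>r. v (r *\<^sub>R f) = r * v f) \<and>
        (\<forall>f\<in>smooth_funs M. \<forall>g\<in>smooth_funs M. v (f * g) = f x * v g + g x * v f) \<and>
        (\<forall>f. f \<notin> smooth_funs M \<longrightarrow> v f = 0)}"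

definition coord_field ::
  "'m smooth_structure \<Rightarrow> 'm set \<Rightarrow> ('m \<Rightarrow> nat \<Rightarrow> real) \<Rightarrow> nat \<Rightarrow> 'm \<Rightarrow> 'm tvec"
  where "coord_field M U \<phi> i x f =
    (if f \<in> smooth_funs M then partial_deriv i (f \<circ> inv_into U \<phi>) (\<phi> x) else 0)"

definition tangent_bundle :: "'m smooth_structure \<Rightarrow> ('m, 'm tvec) vbundle"
  where "tangent_bundle M =
    \<lparr>vrank = mdim M, fib = tangent_space M, frames = (\<lambda>(U, \<phi>). (U, coord_field M U \<phi>)) ` atlas M\<rparr>"

definition dir_deriv :: "('m \<Rightarrow> 'm tvec) \<Rightarrow> ('m \<Rightarrow> real) \<Rightarrow> 'm \<Rightarrow> real"  (infixl "\<rhd>" 80)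
  where "X \<rhd> f = (\<lambda>x. X x f)"

(* on a non-smooth f both inner derivatives are the zero function, so the value is 0 *)
definition vf_bracket :: "('m \<Rightarrow> 'm tvec) \<Rightarrow> ('m \<Rightarrow> 'm tvec) \<Rightarrow> 'm \<Rightarrow> 'm tvec"
  where "vf_bracket X Y = (\<lambda>x f. X x (Y \<rhd> f) - Y x (X \<rhd> f))"


section \<open>Homomorphism bundles and the tensor product with the cotangent bundle\<close>

definition hom_fib :: "'v::real_vector set \<Rightarrow> 'w::real_vector set \<Rightarrow> ('v \<Rightarrow> 'w) set"
  where "hom_fib E F =
    {T. (\<forall>u\<in>E. T u \<in> F) \<and> (\<forall>u\<in>E. \<forall>v\<in>E. T (u + v) = T u + T v) \<and>
        (\<forall>u\<in>E. \<forall>r. T (r *\<^sub>R u) = r *\<^sub>R T u) \<and> (\<forall>u. u \<notin> E \<longrightarrow> T u = 0)}"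

(* the elementary homomorphisms (dual vector of e j) times e' i, enumerated by k = i * m + j
   with j < m, where m is the rank of the source *)
definition hom_frame ::
  "nat \<Rightarrow> ('m \<Rightarrow> 'v::real_vector set) \<Rightarrow> (nat \<Rightarrow> 'm \<Rightarrow> 'v) \<Rightarrow> (nat \<Rightarrow> 'm \<Rightarrow> 'w::real_vector)
    \<Rightarrow> nat \<Rightarrow> 'm \<Rightarrow> 'v \<Rightarrow> 'w"
  where "hom_frame m E e e' k x u =
    (if u \<in> E x
     then representation ((\<lambda>j. e j x) ` {..<m}) u (e (k mod m) x) *\<^sub>R e' (k div m) x
     else 0)"

definition hom_bundle ::
  "('m, 'v::real_vector) vbundle \<Rightarrow> ('m, 'w::real_vector) vbundle \<Rightarrow> ('m, 'v \<Rightarrow> 'w) vbundle"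
  where "hom_bundle A B =
    \<lparr>vrank = vrank A * vrank B,
     fib = (\<lambda>x. hom_fib (fib A x) (fib B x)),
     frames = {(U \<inter> V, hom_frame (vrank A) (fib A) e e') |U e V e'.
                 (U, e) \<in> frames A \<and> (V, e') \<in> frames B}\<rparr>"

(* T*M \<otimes> A is taken to be Hom(TM, A), canonically isomorphic since TM has finite rank;
   an elementary tensor \<omega> \<otimes> a is the map v \<mapsto> \<omega>(v) a. *)
definition cotangent_tensor ::
  "'m smooth_structure \<Rightarrow> ('m, 'v::real_vector) vbundle \<Rightarrow> ('m, 'm tvec \<Rightarrow> 'v) vbundle"
  where "cotangent_tensor M A = hom_bundle (tangent_bundle M) A"

definition differential :: "'m smooth_structure \<Rightarrow> ('m \<Rightarrow> real) \<Rightarrow> 'm \<Rightarrow> 'm tvec \<Rightarrow> real"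
  where "differential M f x v = (if v \<in> tangent_space M x then v f else 0)"

definition tensor ::
  "('m \<Rightarrow> 'm tvec \<Rightarrow> real) \<Rightarrow> ('m \<Rightarrow> 'v::real_vector) \<Rightarrow> 'm \<Rightarrow> 'm tvec \<Rightarrow> 'v"  (infixl "\<otimes>" 77)
  where "\<omega> \<otimes> a = (\<lambda>x v. \<omega> x v *\<^sub>R a x)"


section \<open>Differential operators of order at most one\<close>

definition mult_commutator ::
  "(('m \<Rightarrow> 'v::real_vector) \<Rightarrow> 'm \<Rightarrow> 'w::real_vector) \<Rightarrow> ('m \<Rightarrow> real) \<Rightarrow> ('m \<Rightarrow> 'v) \<Rightarrow> 'm \<Rightarrow> 'w"
  where "mult_commutator \<Delta> f = (\<lambda>a. \<Delta> (f \<cdot> a) - f \<cdot> \<Delta> a)"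

definition diff_op ::
  "'m smooth_structure \<Rightarrow> ('m, 'v::real_vector) vbundle \<Rightarrow> ('m, 'w::real_vector) vbundle
    \<Rightarrow> (('m \<Rightarrow> 'v) \<Rightarrow> 'm \<Rightarrow> 'w) \<Rightarrow> bool"
  where "diff_op M A B \<Delta> \<longleftrightarrow>
    (\<forall>a\<in>\<Gamma> M A. \<Delta> a \<in> \<Gamma> M B) \<and>
    (\<forall>a\<in>\<Gamma> M A. \<forall>b\<in>\<Gamma> M A. \<Delta> (a + b) = \<Delta> a + \<Delta> b) \<and>
    (\<forall>a\<in>\<Gamma> M A. \<forall>r. \<Delta> (r *\<^sub>R a) = r *\<^sub>R \<Delta> a) \<and>
    (\<forall>f\<in>smooth_funs M. \<forall>g\<in>smooth_funs M. \<forall>a\<in>\<Gamma> M A.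
       mult_commutator (mult_commutator \<Delta> f) g a = 0)"

definition on_sections :: "('m \<Rightarrow> 'v \<Rightarrow> 'w) \<Rightarrow> ('m \<Rightarrow> 'v) \<Rightarrow> 'm \<Rightarrow> 'w"
  where "on_sections \<sigma> s = (\<lambda>x. \<sigma> x (s x))"

(* The symbol, a section of TM \<otimes> A* \<otimes> B = Hom(T*M \<otimes> A, B); it is unique, so a predicate
   determines it. *)
definition is_symbol ::
  "'m smooth_structure \<Rightarrow> ('m, 'v::real_vector) vbundle \<Rightarrow> ('m, 'w::real_vector) vbundle
    \<Rightarrow> (('m \<Rightarrow> 'v) \<Rightarrow> 'm \<Rightarrow> 'w) \<Rightarrow> ('m \<Rightarrow> ('m tvec \<Rightarrow> 'v) \<Rightarrow> 'w) \<Rightarrow> bool"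
  where "is_symbol M A B \<Delta> \<sigma> \<longleftrightarrow>
    \<sigma> \<in> \<Gamma> M (hom_bundle (cotangent_tensor M A) B) \<and>
    (\<forall>f\<in>smooth_funs M. \<forall>a\<in>\<Gamma> M A.
       \<Delta> (f \<cdot> a) = f \<cdot> \<Delta> a + on_sections \<sigma> (differential M f \<otimes> a))"


section \<open>Derivative Lie algebras\<close>

definition lie_bracket_on :: "'v::real_vector set \<Rightarrow> ('v \<Rightarrow> 'v \<Rightarrow> 'v) \<Rightarrow> bool"
  where "lie_bracket_on L br \<longleftrightarrow>
    (\<forall>a\<in>L. \<forall>b\<in>L. br a b \<in> L) \<and>
    (\<forall>a\<in>L. \<forall>b\<in>L. \<forall>c\<in>L. br (a + b) c = br a c + br b c \<and> br a (b + c) = br a b + br a c) \<and>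
    (\<forall>a\<in>L. \<forall>b\<in>L. \<forall>r. br (r *\<^sub>R a) b = r *\<^sub>R br a b \<and> br a (r *\<^sub>R b) = r *\<^sub>R br a b) \<and>
    (\<forall>a\<in>L. br a a = 0) \<and>
    (\<forall>a\<in>L. \<forall>b\<in>L. \<forall>c\<in>L. br a (br b c) + br b (br c a) + br c (br a b) = 0)"

(* br is the bracket, lam its symbol a \<mapsto> \<lambda>_a *)
definition derivative_lie_algebra ::
  "'m smooth_structure \<Rightarrow> ('m, 'v::real_vector) vbundle
    \<Rightarrow> (('m \<Rightarrow> 'v) \<Rightarrow> ('m \<Rightarrow> 'v) \<Rightarrow> 'm \<Rightarrow> 'v) \<Rightarrow> (('m \<Rightarrow> 'v) \<Rightarrow> 'm \<Rightarrow> 'm tvec) \<Rightarrow> bool"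
  where "derivative_lie_algebra M A br lam \<longleftrightarrow>
    lie_bracket_on (\<Gamma> M A) br \<and>
    diff_op M A (tangent_bundle M) lam \<and>
    (\<forall>a\<in>\<Gamma> M A. \<forall>b\<in>\<Gamma> M A. \<forall>f\<in>smooth_funs M.
       br a (f \<cdot> b) = f \<cdot> br a b + (lam a \<rhd> f) \<cdot> b)"

(* the symbol of lam, regarded as a map from sections of T*M \<otimes> A to vector fields *)
definition is_squiggle ::
  "'m smooth_structure \<Rightarrow> ('m, 'v::real_vector) vbundle \<Rightarrow> (('m \<Rightarrow> 'v) \<Rightarrow> 'm \<Rightarrow> 'm tvec)
    \<Rightarrow> (('m \<Rightarrow> 'm tvec \<Rightarrow> 'v) \<Rightarrow> 'm \<Rightarrow> 'm tvec) \<Rightarrow> bool"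
  where "is_squiggle M A lam \<Lambda> \<longleftrightarrow>
    (\<exists>\<sigma>. is_symbol M A (tangent_bundle M) lam \<sigma> \<and> \<Lambda> = on_sections \<sigma>)"

end

theory Submission
  imports Defs "HOL-Computational_Algebra.Polynomial"
begin

text \<open>
  Everything follows from the Leibniz rule, antisymmetry and the Jacobi identity. Computing
  \<open>[f \<cdot> a, g \<cdot> b]\<close> in two ways gives the second identity. Replacing \<open>c\<close> by \<open>f \<cdot> c\<close> in the Jacobi
  identity for \<open>a, b, c\<close> shows that \<open>\<lambda>\<^bsub>[a,b]\<^esub>[f] - [\<lambda>\<^bsub>a\<^esub>, \<lambda>\<^bsub>b\<^esub>][f]\<close> annihilates every section \<open>c\<close>; since
  bump functions provide sections that do not vanish at a given point, the third identity follows.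
  The fourth is the third for \<open>a\<close> and \<open>f \<cdot> b\<close>. The fourth for \<open>f \<cdot> a\<close> and \<open>dg \<otimes> b\<close> computes the
  commutator of \<open>\<Lambda>\<^sup>\<sharp>(df \<otimes> a)\<close> and \<open>\<Lambda>\<^sup>\<sharp>(dg \<otimes> b)\<close>; applied to \<open>h\<close> and multiplied by \<open>c\<close>, it
  becomes the last identity after repeated use of the second one.
\<close>

section \<open>Brackets acting by derivations\<close>

lemma fun_scale_apply [simp]: "(f \<cdot> s) x = f x *\<^sub>R s x"
  by (simp add: fun_scale_def)

lemma dir_deriv_apply [simp]: "(X \<rhd> f) x = X x f"
  by (simp add: dir_deriv_def)

text \<open>The last assumption is needed because the Jacobi identity yields
  \<open>\<lambda>\<^bsub>[a,b]\<^esub> = [\<lambda>\<^bsub>a\<^esub>, \<lambda>\<^bsub>b\<^esub>]\<close> only after multiplication by an arbitrary section.\<close>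

locale derivation_bracket =
  fixes R :: "('m \<Rightarrow> real) set" and L :: "('m \<Rightarrow> 'v::real_vector) set"
    and br :: "('m \<Rightarrow> 'v) \<Rightarrow> ('m \<Rightarrow> 'v) \<Rightarrow> 'm \<Rightarrow> 'v"
    and lam :: "('m \<Rightarrow> 'v) \<Rightarrow> 'm \<Rightarrow> 'm tvec"
  assumes R_add: "f \<in> R \<Longrightarrow> g \<in> R \<Longrightarrow> f + g \<in> R"
    and R_mult: "f \<in> R \<Longrightarrow> g \<in> R \<Longrightarrow> f * g \<in> R"
    and R_scaleR: "f \<in> R \<Longrightarrow> r *\<^sub>R f \<in> R"
    and L_add: "a \<in> L \<Longrightarrow> b \<in> L \<Longrightarrow> a + b \<in> L"
    and L_scale: "f \<in> R \<Longrightarrow> a \<in> L \<Longrightarrow> f \<cdot> a \<in> L"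
    and bracket: "lie_bracket_on L br"
    and br_scale_right: "a \<in> L \<Longrightarrow> b \<in> L \<Longrightarrow> f \<in> R \<Longrightarrow> br a (f \<cdot> b) = f \<cdot> br a b + (lam a \<rhd> f) \<cdot> b"
    and lam_closed: "a \<in> L \<Longrightarrow> f \<in> R \<Longrightarrow> lam a \<rhd> f \<in> R"
    and lam_deriv_add: "a \<in> L \<Longrightarrow> f \<in> R \<Longrightarrow> g \<in> R \<Longrightarrow> lam a \<rhd> (f + g) = lam a \<rhd> f + lam a \<rhd> g"
    and lam_deriv_scaleR: "a \<in> L \<Longrightarrow> f \<in> R \<Longrightarrow> lam a \<rhd> (r *\<^sub>R f) = r *\<^sub>R (lam a \<rhd> f)"
    and lam_deriv_mult: "a \<in> L \<Longrightarrow> f \<in> R \<Longrightarrow> g \<in> R \<Longrightarrow>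
      lam a \<rhd> (f * g) = f * (lam a \<rhd> g) + g * (lam a \<rhd> f)"
    and lam_outside: "a \<in> L \<Longrightarrow> f \<notin> R \<Longrightarrow> lam a \<rhd> f = 0"
    and lam_add: "a \<in> L \<Longrightarrow> b \<in> L \<Longrightarrow> lam (a + b) = lam a + lam b"
    and lam_order_one: "f \<in> R \<Longrightarrow> g \<in> R \<Longrightarrow> a \<in> L \<Longrightarrow>
      mult_commutator (mult_commutator lam f) g a = 0"
    and L_nonvanishing: "a \<in> L \<Longrightarrow> a \<noteq> 0 \<Longrightarrow> \<exists>c\<in>L. c x \<noteq> 0"
begin

section \<open>Elementary consequences of the Lie bracket axioms\<close>

lemma br_closed: "a \<in> L \<Longrightarrow> b \<in> L \<Longrightarrow> br a b \<in> L"
  using bracket by (simp add: lie_bracket_on_def)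

lemma br_add_right: "a \<in> L \<Longrightarrow> b \<in> L \<Longrightarrow> c \<in> L \<Longrightarrow> br a (b + c) = br a b + br a c"
  using bracket by (simp add: lie_bracket_on_def)

lemma br_anti:
  assumes "a \<in> L" "b \<in> L"
  shows "br b a = - br a b"
proof -
  have "br (a + b) (a + b) = 0" "br a a = 0" "br b b = 0"
    using bracket assms L_add by (auto simp: lie_bracket_on_def)
  moreover have "br (a + b) (a + b) = br a a + br a b + (br b a + br b b)"
    using bracket assms L_add unfolding lie_bracket_on_def by metis
  ultimately show ?thesis
    by (metis add.commute add.left_neutral add.right_neutral minus_unique)
qed

text \<open>Zero arises as \<open>br a a\<close>, which closure under the bracket puts into
  \<open>L\<close>.\<close>

lemma zero_in_L: "a \<in> L \<Longrightarrow> 0 \<in> L"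
  using bracket br_closed[of a a] by (simp add: lie_bracket_on_def)

lemma R_diff: "f \<in> R \<Longrightarrow> g \<in> R \<Longrightarrow> f - g \<in> R"
  using R_add[of f "(-1) *\<^sub>R g"] R_scaleR[of g "-1"] by simp

lemma lam_deriv_diff:
  "a \<in> L \<Longrightarrow> f \<in> R \<Longrightarrow> g \<in> R \<Longrightarrow> lam a \<rhd> (f - g) = lam a \<rhd> f - lam a \<rhd> g"
  using lam_deriv_add[of a f "(-1) *\<^sub>R g"] lam_deriv_scaleR[of a g "-1"] R_scaleR[of g "-1"]
  by simp

text \<open>If the zero function lies in \<open>R\<close>, this is homogeneity with factor zero;
  otherwise it is the convention that \<open>lam a\<close> vanishes outside
  \<open>R\<close>.\<close>

lemma lam_deriv_zero:
  assumes "a \<in> L"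
  shows "lam a x 0 = 0"
  using fun_cong[OF lam_deriv_scaleR[OF assms, of 0 0], of x] lam_outside[OF assms, of 0]
  by (cases "0 \<in> R") (auto simp: fun_eq_iff)

lemma br_scale_left:
  assumes "a \<in> L" "b \<in> L" "f \<in> R"
  shows "br (f \<cdot> a) b = f \<cdot> br a b - (lam b \<rhd> f) \<cdot> a"
  using br_anti[of b "f \<cdot> a"] br_anti[of a b] br_scale_right[of b a f] assms L_scale
  by (simp add: fun_eq_iff)

lemma br_minus_right:
  assumes "a \<in> L" "b \<in> L"
  shows "br a (- b) = - br a b"
proof -
  have "br a ((-1) *\<^sub>R b) = (-1) *\<^sub>R br a b"
    using bracket assms unfolding lie_bracket_on_def by blast
  then show ?thesis by simp
qed

text \<open>Antisymmetry turns the cyclic form of the Jacobi identity into the derivation form, in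
  which \<open>br a\<close> differentiates the bracket of \<open>b\<close> and
  \<open>c\<close>.\<close>

lemma jacobi:
  assumes "a \<in> L" "b \<in> L" "c \<in> L"
  shows "br a (br b c) = br (br a b) c + br b (br a c)"
proof -
  have "br a (br b c) + br b (br c a) + br c (br a b) = 0"
    using bracket assms by (simp add: lie_bracket_on_def)
  moreover have "br c (br a b) = - br (br a b) c"
    using assms br_anti br_closed by blast
  moreover have "br b (br c a) = - br b (br a c)"
    using assms br_anti[of a c] br_minus_right[of b "br a c"] br_closed by simp
  ultimately show ?thesis
    by (simp add: algebra_simps eq_neg_iff_add_eq_0)
qed

section \<open>The symbol as a homomorphism of brackets\<close>

lemma lam_br_scale:
  assumes "a \<in> L" "b \<in> L" "c \<in> L" "f \<in> R"
  shows "(lam (br a b) \<rhd> f) \<cdot> c = (lam a \<rhd> (lam b \<rhd> f) - lam b \<rhd> (lam a \<rhd> f)) \<cdot> c"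
proof -
  \<comment> \<open>The two terms with one differentiation of \<open>f\<close> are together
    symmetric in \<open>a\<close> and \<open>b\<close>, so they cancel in the commutator of
    \<open>br a\<close> and \<open>br b\<close>.\<close>
  have *: "br a (br b (f \<cdot> c)) = f \<cdot> br a (br b c) + (lam a \<rhd> f) \<cdot> br b c
      + ((lam b \<rhd> f) \<cdot> br a c + (lam a \<rhd> (lam b \<rhd> f)) \<cdot> c)"
    if "a \<in> L" "b \<in> L" for a b
    using that assms(3,4) by (simp add: br_scale_right br_add_right L_scale br_closed lam_closed)
  have "br (br a b) (f \<cdot> c) = br a (br b (f \<cdot> c)) - br b (br a (f \<cdot> c))"
    using jacobi[of a b "f \<cdot> c"] assms by (simp add: L_scale)
  moreover have "br (br a b) (f \<cdot> c) = f \<cdot> br (br a b) c + (lam (br a b) \<rhd> f) \<cdot> c"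
    using assms br_closed br_scale_right by blast
  ultimately show ?thesis
    using jacobi[OF assms(1-3)] unfolding *[OF assms(1,2)] *[OF assms(2,1)]
    by (simp add: fun_eq_iff algebra_simps)
qed

text \<open>A section \<open>c\<close> with \<open>c x \<noteq> 0\<close> can be cancelled from the
  preceding identity at \<open>x\<close>. Such a section is supplied only when \<open>L\<close> has
  a nonzero element, so \<open>a = 0\<close> is treated directly: both sides then vanish.\<close>

lemma lam_br_deriv:
  assumes "a \<in> L" "b \<in> L" "f \<in> R"
  shows "lam (br a b) \<rhd> f = lam a \<rhd> (lam b \<rhd> f) - lam b \<rhd> (lam a \<rhd> f)"
proof (cases "a = 0")
  case True
  have z: "lam 0 = 0"
    using lam_add[of 0 0] zero_in_L[OF assms(1)] by simp
  have "br 0 b = 0"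
    using bracket assms(2) zero_in_L[OF assms(1)] unfolding lie_bracket_on_def
    by (metis scaleR_zero_left)
  \<comment> \<open>For \<open>a = 0\<close> the inner derivative \<open>lam a \<rhd> f\<close> is
    the zero function, written here as \<open>0 *\<^sub>R f\<close> so that homogeneity
    applies.\<close>
  moreover have "lam b \<rhd> (0 *\<^sub>R f) = 0"
    using lam_deriv_scaleR[OF assms(2,3), of 0] by simp
  moreover have "lam 0 \<rhd> g = 0" for g
    using z by (simp add: fun_eq_iff)
  ultimately show ?thesis
    using True by simp
next
  case False
  show ?thesis
  proof
    fix x
    obtain c where "c \<in> L" "c x \<noteq> 0"
      using L_nonvanishing assms(1) False by blast
    with fun_cong[OF lam_br_scale[OF assms(1,2) _ assms(3)], of c x]
    show "(lam (br a b) \<rhd> f) x = (lam a \<rhd> (lam b \<rhd> f) - lam b \<rhd> (lam a \<rhd> f)) x"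
      by simp
  qed
qed

text \<open>Vector fields are compared on all arguments. Outside \<open>R\<close> all derivatives
  vanish, and the bracket differentiates the zero function.\<close>

lemma lam_br:
  assumes "a \<in> L" "b \<in> L"
  shows "lam (br a b) = vf_bracket (lam a) (lam b)"
proof (intro ext)
  fix x f
  show "lam (br a b) x f = vf_bracket (lam a) (lam b) x f"
  proof (cases "f \<in> R")
    case True
    from fun_cong[OF lam_br_deriv[OF assms True], of x] show ?thesis
      by (simp add: vf_bracket_def)
  next
    case False
    have "lam (br a b) x f = 0"
      using fun_cong[OF lam_outside[OF br_closed[OF assms] False], of x] by simp
    then show ?thesis
      using lam_outside[OF assms(1) False] lam_outside[OF assms(2) False] lam_deriv_zero assms
      by (simp add: vf_bracket_def)
  qed
qed

text \<open>\<open>squig f a\<close> is the vector field \<open>\<Lambda>\<^sup>\<sharp>(df \<otimes> a)\<close>.\<close>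

definition squig :: "('m \<Rightarrow> real) \<Rightarrow> ('m \<Rightarrow> 'v) \<Rightarrow> 'm \<Rightarrow> 'm tvec"
  where "squig f a = mult_commutator lam f a"

lemma lam_scale: "lam (f \<cdot> a) = f \<cdot> lam a + squig f a"
  by (simp add: squig_def mult_commutator_def)

lemma squig_deriv: "squig f a \<rhd> g = lam (f \<cdot> a) \<rhd> g - f * (lam a \<rhd> g)"
  by (simp add: squig_def mult_commutator_def fun_eq_iff)

lemma squig_closed: "f \<in> R \<Longrightarrow> a \<in> L \<Longrightarrow> g \<in> R \<Longrightarrow> squig f a \<rhd> g \<in> R"
  by (simp add: squig_deriv R_diff R_mult lam_closed L_scale)

text \<open>Expanding \<open>[f \<cdot> a, g \<cdot> b]\<close> first in the right and then in the left argument, or the other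
  way round, must give the same result.\<close>

lemma squig_swap:
  assumes "a \<in> L" "b \<in> L" "f \<in> R" "g \<in> R"
  shows "(squig f a \<rhd> g) \<cdot> b = - ((squig g b \<rhd> f) \<cdot> a)"
proof -
  have *: "br (f \<cdot> a) (g \<cdot> b) = g \<cdot> (f \<cdot> br a b - (lam b \<rhd> f) \<cdot> a) + (lam (f \<cdot> a) \<rhd> g) \<cdot> b"
    if "a \<in> L" "b \<in> L" "f \<in> R" "g \<in> R" for a b f g
    using that by (simp add: br_scale_right br_scale_left L_scale)
  have "br (f \<cdot> a) (g \<cdot> b) = - br (g \<cdot> b) (f \<cdot> a)"
    using assms L_scale br_anti by blast
  then show ?thesis
    unfolding *[OF assms] *[OF assms(2,1,4,3)] br_anti[OF assms(1,2)] squig_deriv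
    by (simp add: fun_eq_iff algebra_simps)
qed

section \<open>Additivity and tensoriality of the squiggle\<close>

lemma squig_add_left:
  assumes "f \<in> R" "g \<in> R" "a \<in> L"
  shows "squig (f + g) a = squig f a + squig g a"
proof -
  have "(f + g) \<cdot> a = f \<cdot> a + g \<cdot> a"
    by (simp add: fun_eq_iff algebra_simps)
  then have "lam ((f + g) \<cdot> a) = lam (f \<cdot> a) + lam (g \<cdot> a)"
    using assms by (simp add: lam_add L_scale)
  then show ?thesis
    by (simp add: squig_def mult_commutator_def fun_eq_iff algebra_simps)
qed

text \<open>The double commutator of \<open>lam\<close> with \<open>f\<close> and \<open>g\<close>
  is the difference of the two sides, so this is the condition that \<open>lam\<close> has order at
  most one.\<close>

lemma squig_scale_right:
  assumes "f \<in> R" "g \<in> R" "a \<in> L"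
  shows "squig f (g \<cdot> a) = g \<cdot> squig f a"
  using lam_order_one[OF assms] by (simp add: squig_def mult_commutator_def)

text \<open>This reflects \<open>d(f * g) = f dg + g df\<close>: applying \<open>lam\<close> to
  \<open>f \<cdot> (g \<cdot> a)\<close> one factor at a time gives
  \<open>squig f (g \<cdot> a) + f \<cdot> squig g a\<close>, and tensoriality pulls
  \<open>g\<close> out.\<close>

lemma squig_mult_left:
  assumes "f \<in> R" "g \<in> R" "a \<in> L"
  shows "squig (f * g) a = f \<cdot> squig g a + g \<cdot> squig f a"
proof -
  have "(f * g) \<cdot> a = f \<cdot> (g \<cdot> a)"
    by (simp add: fun_eq_iff)
  then have "lam ((f * g) \<cdot> a) = lam (f \<cdot> (g \<cdot> a))"
    by simp
  then have "squig (f * g) a = squig f (g \<cdot> a) + f \<cdot> squig g a"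
    by (simp add: squig_def mult_commutator_def fun_eq_iff algebra_simps)
  then show ?thesis
    using squig_scale_right[OF assms] by (simp add: add.commute)
qed

lemma squig_diff_right:
  assumes "f \<in> R" "a \<in> L" "b \<in> L" "a - b \<in> L"
  shows "squig f (a - b) = squig f a - squig f b"
proof -
  have "f \<cdot> a = f \<cdot> (a - b) + f \<cdot> b"
    by (simp add: fun_eq_iff algebra_simps)
  then have "lam (f \<cdot> a) = lam (f \<cdot> (a - b)) + lam (f \<cdot> b)"
    using assms by (simp add: lam_add L_scale)
  moreover have "lam a = lam (a - b) + lam b"
    using lam_add[of "a - b" b] assms by simp
  ultimately show ?thesis
    by (simp add: squig_def mult_commutator_def fun_eq_iff algebra_simps)
qed

section \<open>Commutators with squiggle fields\<close>

lemma lam_br_scale_right: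
  assumes "a \<in> L" "b \<in> L" "f \<in> R"
  shows "lam (br a (f \<cdot> b)) = f \<cdot> lam (br a b) + squig f (br a b)
    + ((lam a \<rhd> f) \<cdot> lam b + squig (lam a \<rhd> f) b)"
proof -
  have "lam (br a (f \<cdot> b)) = lam (f \<cdot> br a b) + lam ((lam a \<rhd> f) \<cdot> b)"
    using assms by (simp add: br_scale_right lam_add L_scale br_closed lam_closed)
  then show ?thesis
    by (simp add: lam_scale)
qed

lemma vf_bracket_lam_squig:
  assumes "a \<in> L" "b \<in> L" "f \<in> R"
  shows "vf_bracket (lam a) (squig f b) = squig (lam a \<rhd> f) b + squig f (br a b)"
proof (intro ext)
  fix x g
  show "vf_bracket (lam a) (squig f b) x g = (squig (lam a \<rhd> f) b + squig f (br a b)) x g"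
  proof (cases "g \<in> R")
    case True
    \<comment> \<open>Writing \<open>squig f b\<close> as
      \<open>lam (f \<cdot> b) - f \<cdot> lam b\<close> reduces both compositions, in 1 and 2, to
      fields of the form \<open>lam\<close>. Their commutators are then evaluated by the
      homomorphism property for the pairs \<open>a\<close>, \<open>f \<cdot> b\<close> and
      \<open>a\<close>, \<open>b\<close> in 3 and 4.\<close>
    have 1: "lam a \<rhd> (squig f b \<rhd> g) = lam a \<rhd> (lam (f \<cdot> b) \<rhd> g)
      - (f * (lam a \<rhd> (lam b \<rhd> g)) + (lam b \<rhd> g) * (lam a \<rhd> f))"
      unfolding squig_deriv using assms True
      by (simp add: lam_deriv_diff lam_deriv_mult R_mult lam_closed L_scale)
    note 2 = squig_deriv[of f b "lam a \<rhd> g"]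
    note 3 = lam_br_deriv[OF assms(1) L_scale[OF assms(3,2)] True, unfolded lam_br_scale_right[OF assms]]
    note 4 = lam_br_deriv[OF assms(1,2) True]
    show ?thesis
      using 1[THEN fun_cong, of x] 2[THEN fun_cong, of x] 3[THEN fun_cong, of x] 4[THEN fun_cong, of x]
      by (simp add: vf_bracket_def) algebra
  next
    case False
    have o: "squig d e \<rhd> g = 0" if "d \<in> R" "e \<in> L" for d e
      using lam_outside[OF _ False] that L_scale by (simp add: squig_deriv)
    have "squig f b x 0 = 0"
      using lam_deriv_zero assms L_scale by (simp add: squig_def mult_commutator_def)
    then have "vf_bracket (lam a) (squig f b) x g = 0"
      using lam_deriv_zero assms by (simp add: vf_bracket_def o lam_outside[OF _ False])
    then show ?thesis
      using fun_cong[OF o[of "lam a \<rhd> f" b], of x] fun_cong[OF o[of f "br a b"], of x] assms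
      by (simp add: lam_closed br_closed)
  qed
qed

text \<open>Since \<open>squig f a\<close> is \<open>lam (f \<cdot> a) - f \<cdot> lam a\<close>,
  its commutator with \<open>squig g b\<close> is the one of \<open>lam (f \<cdot> a)\<close>, minus
  \<open>f\<close> times the one of \<open>lam a\<close>, plus the term from differentiating
  \<open>f\<close> along \<open>squig g b\<close>. The previous lemma evaluates both commutators,
  and the terms with factor \<open>f\<close> cancel.\<close>

lemma squig_commutator:
  assumes "a \<in> L" "b \<in> L" "f \<in> R" "g \<in> R" "h \<in> R"
  shows "squig f a \<rhd> (squig g b \<rhd> h) - squig g b \<rhd> (squig f a \<rhd> h) =
    (squig g b \<rhd> f) * (lam a \<rhd> h) + (lam a \<rhd> g) * (squig f b \<rhd> h)
    - (lam b \<rhd> f) * (squig g a \<rhd> h) + squig (squig f a \<rhd> g) b \<rhd> h"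
proof -
  note cl = assms L_scale R_mult R_add br_closed lam_closed squig_closed
  have brl: "br (f \<cdot> a) b = f \<cdot> br a b - (lam b \<rhd> f) \<cdot> a"
    using assms by (simp add: br_scale_left)
  \<comment> \<open>By \<open>brl\<close> the difference on the right is the bracket of
    \<open>f \<cdot> a\<close> and \<open>b\<close>, hence a member of \<open>L\<close>, as
    \<open>squig_diff_right\<close> requires.\<close>
  have "squig g (br (f \<cdot> a) b) = squig g (f \<cdot> br a b) - squig g ((lam b \<rhd> f) \<cdot> a)"
    unfolding brl using brl br_closed[of "f \<cdot> a" b] by (intro squig_diff_right) (simp_all add: cl)
  then have 1: "squig g (br (f \<cdot> a) b) = f \<cdot> squig g (br a b) - (lam b \<rhd> f) \<cdot> squig g a"
    by (simp add: squig_scale_right cl)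
  have "lam (f \<cdot> a) \<rhd> g = f * (lam a \<rhd> g) + squig f a \<rhd> g"
    by (simp add: squig_deriv)
  then have 2: "squig (lam (f \<cdot> a) \<rhd> g) b =
    f \<cdot> squig (lam a \<rhd> g) b + (lam a \<rhd> g) \<cdot> squig f b + squig (squig f a \<rhd> g) b"
    by (simp add: squig_add_left squig_mult_left cl)
  have 3: "vf_bracket (lam (f \<cdot> a)) (squig g b) =
      squig (lam (f \<cdot> a) \<rhd> g) b + squig g (br (f \<cdot> a) b)"
    by (intro vf_bracket_lam_squig) (simp_all add: cl)
  have 4: "squig g b \<rhd> (f * (lam a \<rhd> h)) = f * (squig g b \<rhd> (lam a \<rhd> h)) + (lam a \<rhd> h) * (squig g b \<rhd> f)"
    unfolding squig_deriv
    by (simp add: lam_deriv_mult cl) (simp add: algebra_simps fun_eq_iff)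
  have 5: "squig g b \<rhd> (lam (f \<cdot> a) \<rhd> h) = squig g b \<rhd> (f * (lam a \<rhd> h)) + squig g b \<rhd> (squig f a \<rhd> h)"
    unfolding squig_deriv
    by (simp add: lam_deriv_diff cl) (simp add: algebra_simps fun_eq_iff)
  have 6: "squig f a \<rhd> (squig g b \<rhd> h) = lam (f \<cdot> a) \<rhd> (squig g b \<rhd> h) - f * (lam a \<rhd> (squig g b \<rhd> h))"
    by (rule squig_deriv)
  note 7 = vf_bracket_lam_squig[OF assms(1,2,4)]
  show ?thesis
  proof
    fix x
    note v = fun_cong[OF fun_cong[OF 3[unfolded 1 2], of x], of h]
      fun_cong[OF fun_cong[OF 7, of x], of h]
    show "(squig f a \<rhd> (squig g b \<rhd> h) - squig g b \<rhd> (squig f a \<rhd> h)) x =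
     ((squig g b \<rhd> f) * (lam a \<rhd> h) + (lam a \<rhd> g) * (squig f b \<rhd> h)
    - (lam b \<rhd> f) * (squig g a \<rhd> h) + squig (squig f a \<rhd> g) b \<rhd> h) x"
      using v fun_cong[OF 4, of x] fun_cong[OF 5, of x] fun_cong[OF 6, of x]
      by (simp add: vf_bracket_def algebra_simps)
  qed
qed

text \<open>The left side depends on \<open>p\<close> and \<open>c\<close> only through the section
  \<open>p \<cdot> c\<close>, so an equation between two such products can be differentiated along
  \<open>squig g b\<close>. The terms with \<open>br b c\<close> cancel; the price is a correction
  along \<open>b\<close>.\<close>

lemma squig_leibniz:
  assumes "b \<in> L" "c \<in> L" "g \<in> R" "p \<in> R"
  shows "br (g \<cdot> b) (p \<cdot> c) - g \<cdot> br b (p \<cdot> c) = (squig g b \<rhd> p) \<cdot> c - (p * (lam c \<rhd> g)) \<cdot> b"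
  using assms
  by (simp add: br_scale_right br_scale_left L_scale squig_deriv fun_eq_iff algebra_simps)

text \<open>The commutator formula interchanges the two derivatives in the first cyclic term. After
  multiplication by \<open>c\<close>, the interchanged term and the last term of the formula yield
  the negatives of the other two cyclic terms by swapping. What survives is the right-hand
  side.\<close>

lemma squig_cyclic:
  assumes "a \<in> L" "b \<in> L" "c \<in> L" "f \<in> R" "g \<in> R" "h \<in> R"
  shows "(squig f a \<rhd> (squig g b \<rhd> h)) \<cdot> c + (squig g b \<rhd> (squig h c \<rhd> f)) \<cdot> a
      + (squig h c \<rhd> (squig f a \<rhd> g)) \<cdot> b =
    - (((lam b \<rhd> f) * (squig g a \<rhd> h)) \<cdot> c + ((lam c \<rhd> g) * (squig h b \<rhd> f)) \<cdot> a
      + ((lam a \<rhd> h) * (squig f c \<rhd> g)) \<cdot> b)"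
proof -
  note cl = assms squig_closed L_scale
  define p where "p = squig f a \<rhd> h"
  define q where "q = squig h c \<rhd> f"
  have pq: "p \<in> R" "q \<in> R"
    by (simp_all add: p_def q_def cl)
  have eq: "p \<cdot> c = - (q \<cdot> a)"
    unfolding p_def q_def by (rule squig_swap) (simp_all add: cl)
  \<comment> \<open>\<open>a\<close> and \<open>c\<close> cannot be differentiated along \<open>squig g b\<close>, so \<open>eq\<close> is bracketed with
    \<open>g \<cdot> b\<close> instead; this produces the terms with \<open>lam c\<close> and \<open>lam a\<close>.\<close>
  have 1: "(squig g b \<rhd> p) \<cdot> c - (p * (lam c \<rhd> g)) \<cdot> b =
      - ((squig g b \<rhd> q) \<cdot> a - (q * (lam a \<rhd> g)) \<cdot> b)"
    using squig_leibniz[OF assms(2,3,5) pq(1)] squig_leibniz[OF assms(2,1,5) pq(2)]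
    unfolding eq by (simp add: br_minus_right cl pq fun_eq_iff) (metis minus_diff_eq)
  note 2 = squig_commutator[OF assms(1,2,4,5,6)]
  have 3: "(squig (squig f a \<rhd> g) b \<rhd> h) \<cdot> c = - ((squig h c \<rhd> (squig f a \<rhd> g)) \<cdot> b)"
    by (rule squig_swap) (simp_all add: cl)
  \<comment> \<open>This makes the commutator term with \<open>lam a \<rhd> g\<close> cancel against
    the correction with the same factor in 1.\<close>
  have 4: "(squig f b \<rhd> h) \<cdot> c = - (q \<cdot> b)"
    unfolding q_def by (rule squig_swap) (simp_all add: cl)
  have 5: "p \<cdot> b = - ((squig h b \<rhd> f) \<cdot> a)"
    unfolding p_def by (rule squig_swap) (simp_all add: cl)
  have 6: "(squig g b \<rhd> f) \<cdot> c = - ((squig f c \<rhd> g) \<cdot> b)"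
    by (rule squig_swap) (simp_all add: cl)
  show ?thesis
  proof
    fix x
    have "(squig f a \<rhd> (squig g b \<rhd> h)) x = (squig g b \<rhd> p) x +
      (squig g b \<rhd> f) x * (lam a \<rhd> h) x + (lam a \<rhd> g) x * (squig f b \<rhd> h) x
      - (lam b \<rhd> f) x * (squig g a \<rhd> h) x + (squig (squig f a \<rhd> g) b \<rhd> h) x"
      using fun_cong[OF 2, of x] by (simp add: p_def algebra_simps)
    from arg_cong[OF this, of "\<lambda>r. r *\<^sub>R c x"] have A: "((squig f a \<rhd> (squig g b \<rhd> h)) \<cdot> c) x = ((squig g b \<rhd> p) \<cdot> c) x +
      (lam a \<rhd> h) x *\<^sub>R ((squig g b \<rhd> f) \<cdot> c) x + (lam a \<rhd> g) x *\<^sub>R ((squig f b \<rhd> h) \<cdot> c) x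
      - ((lam b \<rhd> f) x * (squig g a \<rhd> h) x) *\<^sub>R c x + ((squig (squig f a \<rhd> g) b \<rhd> h) \<cdot> c) x"
      by (simp add: algebra_simps)
    have B: "((squig g b \<rhd> p) \<cdot> c) x = (lam c \<rhd> g) x *\<^sub>R (p \<cdot> b) x
       - ((squig g b \<rhd> q) \<cdot> a) x + (q x * (lam a \<rhd> g) x) *\<^sub>R b x"
      using fun_cong[OF 1, of x] by (simp add: algebra_simps)
    show "((squig f a \<rhd> (squig g b \<rhd> h)) \<cdot> c + (squig g b \<rhd> (squig h c \<rhd> f)) \<cdot> a
      + (squig h c \<rhd> (squig f a \<rhd> g)) \<cdot> b) x =
    (- (((lam b \<rhd> f) * (squig g a \<rhd> h)) \<cdot> c + ((lam c \<rhd> g) * (squig h b \<rhd> f)) \<cdot> a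
      + ((lam a \<rhd> h) * (squig f c \<rhd> g)) \<cdot> b)) x"
      by (simp only: plus_fun_apply A B 3 4 5 6) (simp add: q_def algebra_simps)
  qed
qed

end


section \<open>Smooth functions on Euclidean space\<close>

text \<open>\<open>Euclidean_space n\<close> carries the subspace topology of the product topology,
  which is also the topology of the type \<open>nat \<Rightarrow> real\<close>. Continuity can
  therefore be treated with \<open>continuous_on\<close>.\<close>

lemma continuous_map_Euclidean_subset:
  "W \<subseteq> topspace (Euclidean_space n) \<Longrightarrow>
    continuous_map (subtopology (Euclidean_space n) W) euclidean F \<longleftrightarrow> continuous_on W F"
  by (simp add: Euclidean_space_def subtopology_subtopology euclidean_product_topology Int_absorb1)

text \<open>Changing a coordinate below \<open>n\<close> keeps those from \<open>n\<close> on zero,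
  and the coordinate line is continuous. Hence partial derivatives at points of \<open>W\<close>
  depend only on values on \<open>W\<close>.\<close>

lemma eventually_coordinate_line:
  assumes "openin (Euclidean_space n) W" "p \<in> W" "i < n"
  shows "\<forall>\<^sub>F t in nhds (p i). p(i := t) \<in> W"
proof -
  obtain T where T: "open T" "W = T \<inter> {x. \<forall>i\<ge>n. x i = 0}"
    using assms(1) by (auto simp: Euclidean_space_def openin_subtopology euclidean_product_topology)
  have "continuous_on UNIV (\<lambda>t. p(i := t))"
    by (rule continuous_on_coordinatewise_then_product) (rename_tac j, case_tac "j = i", simp_all)
  then have "open ((\<lambda>t. p(i := t)) -` T)"
    using T(1) by (rule open_vimage[rotated])
  moreover have "p i \<in> (\<lambda>t. p(i := t)) -` T"
    using assms(2) T(2) by simp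
  ultimately have "\<forall>\<^sub>F t in nhds (p i). p(i := t) \<in> T"
    unfolding eventually_nhds by auto
  then show ?thesis
    by eventually_elim (use assms T in auto)
qed

section \<open>Congruence, closure and locality of \<open>Ck_on\<close>\<close>

lemma Ck_on_subset: "Ck_on n k W F \<Longrightarrow> V \<subseteq> W \<Longrightarrow> Ck_on n k V F"
  by (induction k arbitrary: F) (auto intro: continuous_map_from_subtopology_mono)

lemma Ck_on_Suc_imp: "Ck_on n (Suc k) W F \<Longrightarrow> Ck_on n k W F"
  by (induction k arbitrary: F) auto

lemma line_field_derivative_cong:
  assumes "openin (Euclidean_space n) W" "p \<in> W" "i < n" "\<And>q. q \<in> W \<Longrightarrow> F q = G q"
  shows "((\<lambda>t. F (p(i := t))) has_real_derivative D) (at (p i)) \<longleftrightarrow>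
    ((\<lambda>t. G (p(i := t))) has_real_derivative D) (at (p i))"
  using eventually_coordinate_line[OF assms(1-3)]
  by (intro DERIV_cong_ev refl) (auto elim!: eventually_mono simp: assms(4))

text \<open>Functions that agree on an open \<open>W\<close> have partial derivatives that agree on
  \<open>W\<close>, but perhaps not elsewhere; so the induction runs over arbitrary pairs of such
  functions.\<close>

lemma Ck_on_cong:
  assumes "openin (Euclidean_space n) W" "Ck_on n k W F" "\<And>p. p \<in> W \<Longrightarrow> F p = G p"
  shows "Ck_on n k W G"
  using assms(2,3)
proof (induction k arbitrary: F G)
  case 0
  then show ?case
    using openin_subset[OF assms(1)] continuous_on_cong[of W W F G]
    by (simp add: continuous_map_Euclidean_subset)
next
  case (Suc k)
  have D: "((\<lambda>t. F (p(i := t))) has_real_derivative D) (at (p i)) \<longleftrightarrow>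
      ((\<lambda>t. G (p(i := t))) has_real_derivative D) (at (p i))" if "p \<in> W" "i < n" for p i D
    using line_field_derivative_cong[OF assms(1) that, of F G] Suc.prems(2) by blast
  have "continuous_map (subtopology (Euclidean_space n) W) euclideanreal G"
    using Suc.prems openin_subset[OF assms(1)] continuous_on_cong[of W W F G]
    by (simp add: continuous_map_Euclidean_subset)
  moreover have "(\<lambda>t. G (p(i := t))) field_differentiable at (p i)" if "i < n" "p \<in> W" for i p
    using Suc.prems(1) that D[OF that(2,1)] unfolding Ck_on.simps field_differentiable_def by blast
  moreover have "Ck_on n k W (partial_deriv i G)" if "i < n" for i
  proof (rule Suc.IH)
    show "Ck_on n k W (partial_deriv i F)"
      using Suc.prems(1) that by simp
    show "partial_deriv i F p = partial_deriv i G p" if "p \<in> W" for p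
      unfolding partial_deriv_def deriv_def using D[OF that \<open>i < n\<close>] by simp
  qed
  ultimately show ?case by simp
qed

lemma Ck_on_const: "Ck_on n k W (\<lambda>_. c)"
proof (induction k arbitrary: c)
  case (Suc k)
  have "partial_deriv i (\<lambda>_. c) = (\<lambda>_. 0)" for i
    by (simp add: partial_deriv_def fun_eq_iff)
  with Suc show ?case by simp
qed simp

lemma Ck_on_add:
  assumes "openin (Euclidean_space n) W"
  shows "Ck_on n k W F \<Longrightarrow> Ck_on n k W G \<Longrightarrow> Ck_on n k W (\<lambda>p. F p + G p)"
proof (induction k arbitrary: F G)
  case 0
  then show ?case
    by (auto intro!: continuous_intros)
next
  case (Suc k)
  have "Ck_on n k W (partial_deriv i (\<lambda>p. F p + G p))" if "i < n" for i
  proof (rule Ck_on_cong[OF assms])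
    show "Ck_on n k W (\<lambda>p. partial_deriv i F p + partial_deriv i G p)"
      using Suc that by simp
    show "partial_deriv i F p + partial_deriv i G p = partial_deriv i (\<lambda>p. F p + G p) p"
      if "p \<in> W" for p
      using Suc.prems that \<open>i < n\<close> by (simp add: partial_deriv_def)
  qed
  with Suc.prems show ?case
    by (auto intro!: continuous_intros derivative_intros)
qed

lemma Ck_on_mult:
  assumes "openin (Euclidean_space n) W"
  shows "Ck_on n k W F \<Longrightarrow> Ck_on n k W G \<Longrightarrow> Ck_on n k W (\<lambda>p. F p * G p)"
proof (induction k arbitrary: F G)
  case 0
  then show ?case
    by (auto intro!: continuous_intros)
next
  case (Suc k)
  have "Ck_on n k W (partial_deriv i (\<lambda>p. F p * G p))" if "i < n" for i
  proof (rule Ck_on_cong[OF assms])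
    show "Ck_on n k W (\<lambda>p. F p * partial_deriv i G p + partial_deriv i F p * G p)"
      \<comment> \<open>The product rule contains the undifferentiated factors, which must first be
        lowered from order \<open>Suc k\<close> to \<open>k\<close>.\<close>
      using Suc.prems that Suc.prems[THEN Ck_on_Suc_imp]
      by (intro Ck_on_add[OF assms] Suc.IH) simp_all
    show "F p * partial_deriv i G p + partial_deriv i F p * G p = partial_deriv i (\<lambda>p. F p * G p) p"
      if "p \<in> W" for p
      using Suc.prems that \<open>i < n\<close> by (simp add: partial_deriv_def)
  qed
  with Suc.prems show ?case
    by (auto intro!: continuous_intros derivative_intros)
qed

text \<open>A smooth function \<open>D 0\<close> on the real line given together with all its
  derivatives \<open>D j\<close>, so that the chain rule simply passes from \<open>D j\<close> to
  \<open>D (Suc j)\<close>.\<close>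

definition derivative_tower :: "(nat \<Rightarrow> real \<Rightarrow> real) \<Rightarrow> bool"
  where "derivative_tower D \<longleftrightarrow> (\<forall>j t. (D j has_real_derivative D (Suc j) t) (at t))"

lemma Ck_on_compose:
  assumes "openin (Euclidean_space n) W" "derivative_tower D"
  shows "Ck_on n k W G \<Longrightarrow> Ck_on n k W (\<lambda>p. D j (G p))"
proof (induction k arbitrary: G j)
  case 0
  have "continuous_on UNIV (D j)"
    using assms(2) unfolding derivative_tower_def
    by (meson DERIV_continuous_on has_field_derivative_at_within)
  with 0 show ?case
    using openin_subset[OF assms(1)]
    by (auto simp: continuous_map_Euclidean_subset intro: continuous_on_compose2)
next
  case (Suc k)
  have D: "(D j has_real_derivative D (Suc j) t) (at t)" for j t
    using assms(2) by (simp add: derivative_tower_def)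
  have deriv: "((\<lambda>t. D j (G (p(i := t)))) has_real_derivative D (Suc j) (G p) * partial_deriv i G p)
      (at (p i))" if "i < n" "p \<in> W" for i p
  proof -
    have "((\<lambda>t. G (p(i := t))) has_real_derivative partial_deriv i G p) (at (p i))"
      using Suc.prems that by (simp add: partial_deriv_def DERIV_deriv_iff_field_differentiable)
    from DERIV_chain2[OF _ this, of "D j"] D[of j "G p"] show ?thesis
      by simp
  qed
  have "continuous_map (subtopology (Euclidean_space n) W) euclideanreal (\<lambda>p. D j (G p))"
  proof -
    have "continuous_on UNIV (D j)"
      using D by (meson DERIV_continuous_on has_field_derivative_at_within)
    then show ?thesis
      using Suc.prems openin_subset[OF assms(1)]
      by (auto simp: continuous_map_Euclidean_subset intro: continuous_on_compose2)
  qed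
  moreover have "Ck_on n k W (partial_deriv i (\<lambda>p. D j (G p)))" if "i < n" for i
  proof (rule Ck_on_cong[OF assms(1)])
    show "Ck_on n k W (\<lambda>p. D (Suc j) (G p) * partial_deriv i G p)"
      using Suc.prems that Suc.prems[THEN Ck_on_Suc_imp]
      by (intro Ck_on_mult[OF assms(1)] Suc.IH) simp_all
    show "D (Suc j) (G p) * partial_deriv i G p = partial_deriv i (\<lambda>p. D j (G p)) p"
      if "p \<in> W" for p
      using DERIV_imp_deriv[OF deriv[OF \<open>i < n\<close> that]] by (simp add: partial_deriv_def)
  qed
  ultimately show ?case
    using deriv unfolding Ck_on.simps field_differentiable_def by blast
qed

text \<open>\<open>partial_deriv\<close> does not refer to the set in \<open>Ck_on\<close>, so a
  neighbourhood that works for \<open>F\<close> also works for its partial derivatives.\<close>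

lemma Ck_on_local:
  assumes "openin (Euclidean_space n) W"
    and "\<And>p. p \<in> W \<Longrightarrow> \<exists>V. openin (Euclidean_space n) V \<and> p \<in> V \<and> V \<subseteq> W \<and> Ck_on n k V F"
  shows "Ck_on n k W F"
proof -
  have cont: "continuous_map (subtopology (Euclidean_space n) W) euclideanreal F"
    if loc: "\<And>p. p \<in> W \<Longrightarrow> \<exists>V. openin (Euclidean_space n) V \<and> p \<in> V \<and> V \<subseteq> W \<and>
      continuous_map (subtopology (Euclidean_space n) V) euclideanreal F" for F
    unfolding continuous_map_Euclidean_subset[OF openin_subset[OF assms(1)]]
      continuous_on_eq_continuous_within
  proof
    fix p assume "p \<in> W"
    then obtain V where V: "openin (Euclidean_space n) V" "p \<in> V" "V \<subseteq> W" "continuous_on V F"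
      using loc continuous_map_Euclidean_subset openin_subset by metis
    obtain T where T: "open T" "V = T \<inter> {x. \<forall>i\<ge>n. x i = 0}"
      using V(1) by (auto simp: Euclidean_space_def openin_subtopology euclidean_product_topology)
    \<comment> \<open>\<open>V\<close> is open only relative to \<open>Euclidean_space n\<close>. As
      the trace on \<open>W\<close> of the open set \<open>T\<close>, it gives the same limits at
      \<open>p\<close> as \<open>W\<close> does.\<close>
    have "V = W \<inter> T"
      using T(2) V(3) openin_subset[OF assms(1)] by (auto simp: topspace_Euclidean_space)
    then have "at p within W = at p within V"
      using T(1) V(2) by (intro at_within_nhd[of p T]) auto
    then show "continuous (at p within W) F"
      using V(2,4) by (simp add: continuous_on_eq_continuous_within)
  qed
  show ?thesis
    using assms(2)
  proof (induction k arbitrary: F)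
    case 0
    then show ?case
      using cont by simp
  next
    case (Suc k)
    have "continuous_map (subtopology (Euclidean_space n) W) euclideanreal F"
      using Suc.prems by (intro cont) (auto, metis)
    moreover have "(\<lambda>t. F (p(i := t))) field_differentiable at (p i)" if "i < n" "p \<in> W" for i p
      using Suc.prems[OF that(2)] that(1) by auto
    moreover have "Ck_on n k W (partial_deriv i F)" if "i < n" for i
      using Suc.prems that by (intro Suc.IH) (auto, metis)
    ultimately show ?case by simp
  qed
qed

text \<open>The successive derivatives of \<open>exp (- 1 / t)\<close>, extended by \<open>0\<close> to \<open>t \<le> 0\<close>; with \<open>u = 1 / t\<close>,
  the derivative of \<open>q(u) exp (- u)\<close> is \<open>u\<^sup>2 (q(u) - q'(u)) exp (- u)\<close>.\<close>

definition flat_exp :: "nat \<Rightarrow> real \<Rightarrow> real"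
  where "flat_exp j t = (if 0 < t
    then poly (((\<lambda>q. [:0, 0, 1:] * (q - pderiv q)) ^^ j) 1) (inverse t) * exp (- inverse t) else 0)"

section \<open>A smooth function that is flat at the origin\<close>

lemma poly_times_exp_minus_tendsto_0: "((\<lambda>u. poly q u * exp (- u)) \<longlongrightarrow> (0::real)) at_top"
proof -
  have "((\<lambda>u. \<Sum>i\<le>degree q. coeff q i * (u ^ i / exp u)) \<longlongrightarrow> (\<Sum>i\<le>degree q. coeff q i * 0)) at_top"
    by (intro tendsto_intros tendsto_power_div_exp_0)
  moreover have "(\<Sum>i\<le>degree q. coeff q i * (u ^ i / exp u)) = poly q u * exp (- u)" for u
    by (simp add: poly_altdef exp_minus sum_distrib_right divide_inverse mult.assoc)
  ultimately show ?thesis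
    by simp
qed

lemma derivative_tower_flat_exp: "derivative_tower flat_exp"
  unfolding derivative_tower_def
proof (intro allI)
  fix j :: nat and t :: real
  define q where "q = ((\<lambda>q. [:0, 0, 1:] * (q - pderiv q)) ^^ j) (1 :: real poly)"
  have fe: "flat_exp j s = (if 0 < s then poly q (inverse s) * exp (- inverse s) else 0)" for s
    by (simp add: flat_exp_def q_def)
  have fes: "flat_exp (Suc j) s = (if 0 < s
      then (inverse s)\<^sup>2 * (poly q (inverse s) - poly (pderiv q) (inverse s)) * exp (- inverse s) else 0)" for s
    by (simp add: flat_exp_def q_def power2_eq_square algebra_simps)
  consider "t < 0" | "t = 0" | "0 < t" by linarith
  then show "(flat_exp j has_real_derivative flat_exp (Suc j) t) (at t)"
  proof cases
    case 1
    have "((\<lambda>_. 0) has_real_derivative 0) (at t)"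
      by simp
    moreover have "\<forall>\<^sub>F s in nhds t. flat_exp j s = 0"
      using eventually_nhds_in_open[of "{..<0}" t] 1 by (auto elim!: eventually_mono simp: fe)
    ultimately show ?thesis
      using 1 by (subst DERIV_cong_ev[OF refl _ refl]) (auto simp: fes)
  next
    case 2
    \<comment> \<open>With \<open>u = 1 / s\<close>, the additional factor \<open>u\<close> in
      \<open>pCons 0 q\<close> accounts for the division by \<open>s\<close> in the difference
      quotient at zero.\<close>
    have "((\<lambda>u. poly (pCons 0 q) u * exp (- u)) \<longlongrightarrow> 0) at_top"
      by (rule poly_times_exp_minus_tendsto_0)
    from filterlim_compose[OF this filterlim_inverse_at_top_right]
    have "((\<lambda>s. flat_exp j s / s) \<longlongrightarrow> 0) (at_right 0)"
      by (rule Lim_transform_eventually)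
        (auto simp: eventually_at_right_field fe field_simps intro!: exI[of _ 1])
    moreover have "((\<lambda>s. flat_exp j s / s) \<longlongrightarrow> 0) (at_left 0)"
      by (rule Lim_transform_eventually[OF tendsto_const])
        (auto simp: eventually_at_left_field fe intro!: exI[of _ "-1"])
    ultimately have "((\<lambda>s. flat_exp j s / s) \<longlongrightarrow> 0) (at 0)"
      by (simp add: filterlim_split_at)
    then show ?thesis
      using 2 by (simp add: has_field_derivative_iff fe[of 0] fes[of 0])
  next
    case 3
    have "((\<lambda>s. poly q (inverse s) * exp (- inverse s)) has_real_derivative flat_exp (Suc j) t) (at t)"
      using 3
      by (auto intro!: derivative_eq_intros DERIV_chain2[OF poly_DERIV] simp: fes power2_eq_square algebra_simps)
    moreover have "\<forall>\<^sub>F s in nhds t. flat_exp j s = poly q (inverse s) * exp (- inverse s)"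
      using eventually_nhds_in_open[of "{0<..}" t] 3 by (auto elim!: eventually_mono simp: fe)
    ultimately show ?thesis
      by (subst DERIV_cong_ev[OF refl _ refl]) auto
  qed
qed

lemma flat_exp_0_eq_0_iff: "flat_exp 0 t = 0 \<longleftrightarrow> t \<le> 0"
  by (auto simp: flat_exp_def)

lemma smooth_on_cong:
  "openin (Euclidean_space n) W \<Longrightarrow> smooth_on n W F \<Longrightarrow> (\<And>p. p \<in> W \<Longrightarrow> F p = G p) \<Longrightarrow> smooth_on n W G"
  unfolding smooth_on_def using Ck_on_cong by blast

lemma smooth_on_subset: "smooth_on n W F \<Longrightarrow> V \<subseteq> W \<Longrightarrow> smooth_on n V F"
  unfolding smooth_on_def using Ck_on_subset by blast

lemma smooth_on_const: "smooth_on n W (\<lambda>_. c)"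
  by (simp add: smooth_on_def Ck_on_const)

lemma smooth_on_add:
  "openin (Euclidean_space n) W \<Longrightarrow> smooth_on n W F \<Longrightarrow> smooth_on n W G \<Longrightarrow> smooth_on n W (\<lambda>p. F p + G p)"
  by (simp add: smooth_on_def Ck_on_add)

lemma smooth_on_mult:
  "openin (Euclidean_space n) W \<Longrightarrow> smooth_on n W F \<Longrightarrow> smooth_on n W G \<Longrightarrow> smooth_on n W (\<lambda>p. F p * G p)"
  by (simp add: smooth_on_def Ck_on_mult)

lemma smooth_on_sum:
  assumes "openin (Euclidean_space n) W" "\<And>i. i \<in> I \<Longrightarrow> smooth_on n W (F i)"
  shows "smooth_on n W (\<lambda>p. \<Sum>i\<in>I. F i p)"
  using assms(2)
  by (induction I rule: infinite_finite_induct) (simp_all add: smooth_on_const smooth_on_add assms(1))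

lemma smooth_on_compose:
  "openin (Euclidean_space n) W \<Longrightarrow> derivative_tower D \<Longrightarrow> smooth_on n W G \<Longrightarrow> smooth_on n W (\<lambda>p. D j (G p))"
  unfolding smooth_on_def using Ck_on_compose[of n W D _ G j] by blast

lemma smooth_on_partial_deriv: "smooth_on n W F \<Longrightarrow> i < n \<Longrightarrow> smooth_on n W (partial_deriv i F)"
  unfolding smooth_on_def using Ck_on.simps(2) by blast

lemma smooth_on_local:
  assumes "openin (Euclidean_space n) W"
    and "\<And>p. p \<in> W \<Longrightarrow> \<exists>V. openin (Euclidean_space n) V \<and> p \<in> V \<and> V \<subseteq> W \<and> smooth_on n V F"
  shows "smooth_on n W F"
  unfolding smooth_on_def
proof
  fix k
  show "Ck_on n k W F"
    by (rule Ck_on_local[OF assms(1)]) (use assms(2) in \<open>unfold smooth_on_def, meson\<close>)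
qed

lemma sum_fun_apply: "(\<Sum>i\<in>I. F i) x = (\<Sum>i\<in>I. F i x)"
  by (induction I rule: infinite_finite_induct) auto


section \<open>Bump functions and sections\<close>

lemma Euclidean_cube_in_open:
  assumes "openin (Euclidean_space n) W" "p \<in> W"
  obtains \<epsilon> where "0 < \<epsilon>" "{q \<in> topspace (Euclidean_space n). \<forall>i<n. \<bar>q i - p i\<bar> \<le> \<epsilon>} \<subseteq> W"
proof -
  obtain T where T: "open T" "W = T \<inter> {x. \<forall>i\<ge>n. x i = 0}"
    using assms(1) by (auto simp: Euclidean_space_def openin_subtopology euclidean_product_topology)
  have "p \<in> T" using assms(2) T by simp
  have op: "openin (powertop_real UNIV) T"
    using T(1) by (simp add: euclidean_product_topology)
  obtain X where X: "p \<in> Pi\<^sub>E UNIV X" "\<And>i. open (X i)" "Pi\<^sub>E UNIV X \<subseteq> T"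
    using product_topology_open_contains_basis[OF op \<open>p \<in> T\<close>]
    by (metis open_openin)
  have "\<exists>e>0. cball (p i) e \<subseteq> X i" for i
  proof -
    have "p i \<in> X i" using X(1) by (simp add: PiE_iff)
    then show ?thesis using X(2)[of i] open_contains_cball by blast
  qed
  then obtain e where e: "\<And>i. 0 < e i" "\<And>i. cball (p i) (e i) \<subseteq> X i"
    by metis
  \<comment> \<open>The element \<open>1\<close> keeps the minimum well defined in dimension
    zero.\<close>
  define d where "d = Min (insert 1 (e ` {..<n}))"
  have d: "0 < d" "\<And>i. i < n \<Longrightarrow> d \<le> e i"
    using e(1) by (auto simp: d_def)
  have "q \<in> W" if q: "q \<in> topspace (Euclidean_space n)" "\<forall>i<n. \<bar>q i - p i\<bar> \<le> d" for q
  proof -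
    have "q i \<in> X i" for i
    proof (cases "i < n")
      case True
      then have "\<bar>q i - p i\<bar> \<le> e i"
        using q(2) d(2)[OF True] order_trans by blast
      then have "q i \<in> cball (p i) (e i)"
        by (simp add: dist_real_def abs_minus_commute)
      then show ?thesis using e(2) by blast
    next
      case False
      then have "q i = p i"
        using q(1) assms(2) T(2) by (simp add: topspace_Euclidean_space)
      then show ?thesis using X(1) by (simp add: PiE_iff)
    qed
    then have "q \<in> Pi\<^sub>E UNIV X" by (simp add: PiE_iff)
    then have "q \<in> T" using X(3) by blast
    then show ?thesis using q(1) T(2) by (simp add: topspace_Euclidean_space)
  qed
  with d(1) that show ?thesis by blast
qed

text \<open>Tychonoff: the cube is a product of closed intervals below \<open>n\<close> and of the
  one-point set \<open>{0}\<close> from \<open>n\<close> on.\<close>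

lemma compact_Euclidean_cube:
  assumes "p \<in> topspace (Euclidean_space n)"
  shows "compactin (Euclidean_space n) {q \<in> topspace (Euclidean_space n). \<forall>i<n. \<bar>q i - p i\<bar> \<le> \<epsilon>}"
proof -
  have eq: "{q \<in> topspace (Euclidean_space n). \<forall>i<n. \<bar>q i - p i\<bar> \<le> \<epsilon>} =
      Pi\<^sub>E UNIV (\<lambda>i. if i < n then cball (p i) \<epsilon> else {0})"
    by (auto simp: topspace_Euclidean_space PiE_iff dist_real_def abs_minus_commute Ball_def
        split: if_splits)
  have "compactin (powertop_real UNIV) (Pi\<^sub>E UNIV (\<lambda>i. if i < n then cball (p i) \<epsilon> else {0}))"
    by (auto simp: compactin_PiE)
  then have "compactin (powertop_real UNIV) {q \<in> topspace (Euclidean_space n). \<forall>i<n. \<bar>q i - p i\<bar> \<le> \<epsilon>}"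
    unfolding eq .
  then show ?thesis
    unfolding Euclidean_space_def compactin_subtopology by auto
qed

section \<open>Charts and smooth functions on a manifold\<close>

context
  fixes M :: "'m::{t2_space,second_countable_topology} smooth_structure"
  assumes M: "smooth_manifold M"
begin

lemma chart_at: obtains U \<phi> where "(U, \<phi>) \<in> atlas M" "x \<in> U"
proof -
  have "(\<Union>(U, \<phi>)\<in>atlas M. U) = UNIV"
    using M unfolding smooth_manifold_def by (elim conjE)
  then have "x \<in> (\<Union>(U, \<phi>)\<in>atlas M. U)"
    by simp
  then show ?thesis
    using that by auto
qed

lemma chart:
  assumes "(U, \<phi>) \<in> atlas M"
  shows chart_open: "open U"
    and chart_image_open: "openin (Euclidean_space (mdim M)) (\<phi> ` U)"
    and chart_homeo: "homeomorphic_map (top_of_set U) (subtopology (Euclidean_space (mdim M)) (\<phi> ` U)) \<phi>"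
proof -
  have "\<forall>(U, \<phi>)\<in>atlas M. open U \<and> openin (Euclidean_space (mdim M)) (\<phi> ` U) \<and>
      homeomorphic_map (top_of_set U) (subtopology (Euclidean_space (mdim M)) (\<phi> ` U)) \<phi>"
    using M unfolding smooth_manifold_def by (elim conjE)
  from bspec[OF this assms] show "open U" "openin (Euclidean_space (mdim M)) (\<phi> ` U)"
    "homeomorphic_map (top_of_set U) (subtopology (Euclidean_space (mdim M)) (\<phi> ` U)) \<phi>"
    by simp_all
qed

lemma chart_inj: "(U, \<phi>) \<in> atlas M \<Longrightarrow> inj_on \<phi> U"
  using homeomorphic_imp_injective_map[OF chart_homeo] by simp

lemma chart_openin:
  assumes "(U, \<phi>) \<in> atlas M" "open S"
  shows "openin (Euclidean_space (mdim M)) (\<phi> ` (U \<inter> S))"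
proof -
  have "openin (subtopology (Euclidean_space (mdim M)) (\<phi> ` U)) (\<phi> ` (U \<inter> S))"
    using homeomorphic_imp_open_map[OF chart_homeo[OF assms(1)]] assms(2)
    by (simp add: open_map_def openin_open_Int)
  then show ?thesis
    using openin_trans_full chart_image_open[OF assms(1)] by blast
qed

text \<open>\<open>F U \<phi>\<close> is any convenient coordinate expression of \<open>f\<close> in
  the chart; as the image is open, agreement on it is enough.\<close>

lemma smooth_funs_onI:
  assumes "open S" "\<And>U \<phi>. (U, \<phi>) \<in> atlas M \<Longrightarrow> smooth_on (mdim M) (\<phi> ` (U \<inter> S)) (F U \<phi>)"
    and "\<And>U \<phi> x. (U, \<phi>) \<in> atlas M \<Longrightarrow> x \<in> U \<Longrightarrow> x \<in> S \<Longrightarrow> F U \<phi> (\<phi> x) = f x"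
  shows "f \<in> smooth_funs_on M S"
  unfolding smooth_funs_on_def
proof (clarify)
  fix U \<phi> assume c: "(U, \<phi>) \<in> atlas M"
  show "smooth_on (mdim M) (\<phi> ` (U \<inter> S)) (f \<circ> inv_into U \<phi>)"
    by (rule smooth_on_cong[OF chart_openin[OF c assms(1)] assms(2)[OF c]])
      (use chart_inj[OF c] assms(3)[OF c] in auto)
qed

lemma smooth_funs_onD:
  "f \<in> smooth_funs_on M S \<Longrightarrow> (U, \<phi>) \<in> atlas M \<Longrightarrow>
    smooth_on (mdim M) (\<phi> ` (U \<inter> S)) (\<lambda>p. f (inv_into U \<phi> p))"
  by (auto simp: smooth_funs_on_def o_def)

lemma smooth_funs_on_subset:
  "f \<in> smooth_funs_on M S \<Longrightarrow> T \<subseteq> S \<Longrightarrow> f \<in> smooth_funs_on M T"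
  unfolding smooth_funs_on_def by (force intro: smooth_on_subset)

lemma smooth_funs_on_cong:
  "open S \<Longrightarrow> f \<in> smooth_funs_on M S \<Longrightarrow> (\<And>x. x \<in> S \<Longrightarrow> f x = g x) \<Longrightarrow> g \<in> smooth_funs_on M S"
  by (rule smooth_funs_onI[where F = "\<lambda>U \<phi> p. f (inv_into U \<phi> p)"])
    (simp_all add: smooth_funs_onD chart_inj)

lemma smooth_funs_on_const: "open S \<Longrightarrow> (\<lambda>_. c) \<in> smooth_funs_on M S"
  by (rule smooth_funs_onI[where F = "\<lambda>_ _ _. c"]) (simp_all add: smooth_on_const)

lemma smooth_funs_on_add:
  "open S \<Longrightarrow> f \<in> smooth_funs_on M S \<Longrightarrow> g \<in> smooth_funs_on M S \<Longrightarrow> f + g \<in> smooth_funs_on M S"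
  by (rule smooth_funs_onI[where F = "\<lambda>U \<phi> p. f (inv_into U \<phi> p) + g (inv_into U \<phi> p)"])
    (simp_all add: smooth_funs_onD chart_inj smooth_on_add chart_openin)

lemma smooth_funs_on_mult:
  "open S \<Longrightarrow> f \<in> smooth_funs_on M S \<Longrightarrow> g \<in> smooth_funs_on M S \<Longrightarrow> f * g \<in> smooth_funs_on M S"
  by (rule smooth_funs_onI[where F = "\<lambda>U \<phi> p. f (inv_into U \<phi> p) * g (inv_into U \<phi> p)"])
    (simp_all add: smooth_funs_onD chart_inj smooth_on_mult chart_openin)

lemma smooth_funs_on_scaleR:
  "open S \<Longrightarrow> f \<in> smooth_funs_on M S \<Longrightarrow> r *\<^sub>R f \<in> smooth_funs_on M S"
  by (rule smooth_funs_onI[where F = "\<lambda>U \<phi> p. r * f (inv_into U \<phi> p)"])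
    (simp_all add: smooth_funs_onD chart_inj smooth_on_mult smooth_on_const chart_openin)

lemma smooth_funs_on_compose:
  "open S \<Longrightarrow> derivative_tower D \<Longrightarrow> f \<in> smooth_funs_on M S \<Longrightarrow> (\<lambda>x. D j (f x)) \<in> smooth_funs_on M S"
  by (rule smooth_funs_onI[where F = "\<lambda>U \<phi> p. D j (f (inv_into U \<phi> p))"])
    (simp_all add: smooth_on_compose[of _ _ D _ j, OF chart_openin _ smooth_funs_onD] chart_inj)

lemma smooth_funs_on_prod:
  assumes "open S" "\<And>i. i \<in> I \<Longrightarrow> f i \<in> smooth_funs_on M S"
  shows "(\<lambda>x. \<Prod>i\<in>I. f i x) \<in> smooth_funs_on M S"
  using assms(2)
proof (induction I rule: infinite_finite_induct)
  case (insert i I)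
  then have "f i * (\<lambda>x. \<Prod>i\<in>I. f i x) \<in> smooth_funs_on M S"
    by (intro smooth_funs_on_mult assms(1)) auto
  then show ?case
    using insert.hyps by (simp add: times_fun_def)
qed (simp_all add: smooth_funs_on_const assms(1))

lemma smooth_funs_on_local:
  assumes "open S" "\<And>x. x \<in> S \<Longrightarrow> \<exists>T. open T \<and> x \<in> T \<and> f \<in> smooth_funs_on M (S \<inter> T)"
  shows "f \<in> smooth_funs_on M S"
  unfolding smooth_funs_on_def
proof clarify
  fix U \<phi> assume c: "(U, \<phi>) \<in> atlas M"
  show "smooth_on (mdim M) (\<phi> ` (U \<inter> S)) (f \<circ> inv_into U \<phi>)"
  proof (rule smooth_on_local[OF chart_openin[OF c assms(1)]])
    fix p assume "p \<in> \<phi> ` (U \<inter> S)"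
    then obtain x where x: "x \<in> U" "x \<in> S" "p = \<phi> x" by blast
    then obtain T where T: "open T" "x \<in> T" "f \<in> smooth_funs_on M (S \<inter> T)"
      using assms(2) by blast
    have "openin (Euclidean_space (mdim M)) (\<phi> ` (U \<inter> (S \<inter> T)))"
      using chart_openin[OF c] assms(1) T(1) by blast
    moreover have "smooth_on (mdim M) (\<phi> ` (U \<inter> (S \<inter> T))) (f \<circ> inv_into U \<phi>)"
      using T(3) c unfolding smooth_funs_on_def by auto
    ultimately show "\<exists>V. openin (Euclidean_space (mdim M)) V \<and> p \<in> V \<and> V \<subseteq> \<phi> ` (U \<inter> S) \<and>
        smooth_on (mdim M) V (f \<circ> inv_into U \<phi>)"
      using x T(2) by (intro exI[of _ "\<phi> ` (U \<inter> (S \<inter> T))"]) auto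
  qed
qed

text \<open>The coordinate expression of a component of \<open>\<psi>\<close> in another chart is a
  component of the transition map.\<close>

lemma chart_coordinate_smooth:
  assumes "(V, \<psi>) \<in> atlas M" "i < mdim M"
  shows "(\<lambda>x. \<psi> x i) \<in> smooth_funs_on M V"
proof -
  have "\<forall>(U, \<phi>)\<in>atlas M. \<forall>(V, \<psi>)\<in>atlas M. \<forall>i<mdim M.
       smooth_on (mdim M) (\<phi> ` (U \<inter> V)) (\<lambda>p. \<psi> (inv_into U \<phi> p) i)"
    using M unfolding smooth_manifold_def by (elim conjE)
  then show ?thesis
    using assms by (fastforce simp: smooth_funs_on_def o_def)
qed

text \<open>A product of functions of one coordinate each: its smoothness in the other charts then needs
  only a chain rule for outer functions of one variable.\<close>

lemma bump_function:
  fixes x :: 'm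
  assumes "open W" "x \<in> W"
  obtains \<rho> K where "\<rho> \<in> smooth_funs M" "closed K" "K \<subseteq> W" "\<rho> x \<noteq> 0" "\<And>y. y \<notin> K \<Longrightarrow> \<rho> y = 0"
proof -
  obtain U \<phi> where c: "(U, \<phi>) \<in> atlas M" "x \<in> U" by (rule chart_at)
  note oU = chart_open[OF c(1)]
  let ?E = "Euclidean_space (mdim M)"
  have sub: "\<phi> ` U \<subseteq> topspace ?E"
    using openin_subset[OF chart_image_open[OF c(1)]] .
  obtain \<epsilon> where \<epsilon>: "0 < \<epsilon>"
    "{q \<in> topspace ?E. \<forall>i<mdim M. \<bar>q i - \<phi> x i\<bar> \<le> \<epsilon>} \<subseteq> \<phi> ` (U \<inter> W)" (is "?C \<subseteq> _")
    using Euclidean_cube_in_open[OF chart_openin[OF c(1) assms(1)], of "\<phi> x"] c(2) assms(2) by blast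
  define K where "K = {y \<in> U \<inter> W. \<phi> y \<in> ?C}"
  have K_eq: "K = inv_into U \<phi> ` ?C"
  proof (intro equalityI subsetI)
    fix y assume "y \<in> K"
    then show "y \<in> inv_into U \<phi> ` ?C"
      using chart_inj[OF c(1)] unfolding K_def
      by (intro image_eqI[of _ _ "\<phi> y"]) auto
  next
    fix y assume "y \<in> inv_into U \<phi> ` ?C"
    then obtain q where q: "q \<in> ?C" "y = inv_into U \<phi> q" by blast
    then obtain z where "z \<in> U \<inter> W" "q = \<phi> z" using \<epsilon>(2) by blast
    then show "y \<in> K"
      using q chart_inj[OF c(1)] unfolding K_def by auto
  qed
  have C: "compactin (subtopology ?E (\<phi> ` U)) ?C"
    using compact_Euclidean_cube[of "\<phi> x" "mdim M" \<epsilon>] \<epsilon>(2) sub c(2)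
    unfolding compactin_subtopology by blast
  have inv: "continuous_map (subtopology ?E (\<phi> ` U)) (top_of_set U) (inv_into U \<phi>)"
  proof -
    obtain \<psi> where \<psi>: "homeomorphic_maps (top_of_set U) (subtopology ?E (\<phi> ` U)) \<phi> \<psi>"
      using chart_homeo[OF c(1)] homeomorphic_map_maps by blast
    have "\<psi> p = inv_into U \<phi> p" if "p \<in> \<phi> ` U" for p
      using \<psi> that chart_inj[OF c(1)] by (auto simp: homeomorphic_maps_def)
    with \<psi> sub show ?thesis
      unfolding homeomorphic_maps_def
      by (auto intro: continuous_map_eq)
  qed
  have "compactin (top_of_set U) K"
    unfolding K_eq by (rule image_compactin[OF C inv])
  then have "compact K"
    by (simp add: compactin_subtopology)
  \<comment> \<open>The Hausdorff property enters here: the compact set \<open>K\<close> is closed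
    in the whole manifold, not only in the chart domain.\<close>
  then have K: "closed K" "K \<subseteq> U \<inter> W"
    by (auto simp: compact_imp_closed K_def)
  \<comment> \<open>Nonzero exactly where the \<open>i\<close>-th coordinate differs from that of
    \<open>x\<close> by less than \<open>\<epsilon>\<close>. At each point of the chart outside the
    open cube some factor vanishes, so the cut-off at \<open>K\<close> changes nothing on
    \<open>U \<inter> W\<close>.\<close>
  define w where "w i y = flat_exp 0 (\<epsilon> + (\<phi> y i - \<phi> x i)) * flat_exp 0 (\<epsilon> - (\<phi> y i - \<phi> x i))" for i y
  define \<rho> where "\<rho> y = (if y \<in> K then \<Prod>i<mdim M. w i y else 0)" for y
  have wpos: "w i y = 0 \<longleftrightarrow> \<epsilon> \<le> \<bar>\<phi> y i - \<phi> x i\<bar>" for i y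
    by (auto simp: w_def flat_exp_0_eq_0_iff)
  have w: "w i \<in> smooth_funs_on M U" if "i < mdim M" for i
  proof -
    have aff: "(\<lambda>y. \<alpha> + \<beta> * \<phi> y i) \<in> smooth_funs_on M U" for \<alpha> \<beta>
      using smooth_funs_on_add[OF oU smooth_funs_on_const[OF oU, of \<alpha>]
          smooth_funs_on_scaleR[OF oU chart_coordinate_smooth[OF c(1) that], of \<beta>]]
      by (simp add: plus_fun_def scaleR_fun_def)
    note fe = smooth_funs_on_compose[OF oU derivative_tower_flat_exp aff]
    have "(\<lambda>y. flat_exp 0 ((\<epsilon> - \<phi> x i) + 1 * \<phi> y i)) * (\<lambda>y. flat_exp 0 ((\<epsilon> + \<phi> x i) + (-1) * \<phi> y i))
        \<in> smooth_funs_on M U"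
      by (intro smooth_funs_on_mult oU fe)
    then show ?thesis
      by (rule smooth_funs_on_cong[OF oU]) (simp add: w_def algebra_simps)
  qed
  have "\<rho> \<in> smooth_funs M"
  proof (rule smooth_funs_on_local[OF open_UNIV])
    fix z
    show "\<exists>T. open T \<and> z \<in> T \<and> \<rho> \<in> smooth_funs_on M (UNIV \<inter> T)"
    proof (cases "z \<in> K")
      case True
      have o: "open (U \<inter> W)" using oU assms(1) by blast
      have "(\<lambda>y. \<Prod>i\<in>{..<mdim M}. w i y) \<in> smooth_funs_on M (U \<inter> W)"
        using w by (intro smooth_funs_on_prod o) (auto intro: smooth_funs_on_subset)
      then have "\<rho> \<in> smooth_funs_on M (U \<inter> W)"
      proof (rule smooth_funs_on_cong[OF o])
        fix y assume y: "y \<in> U \<inter> W"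
        show "(\<Prod>i\<in>{..<mdim M}. w i y) = \<rho> y"
        proof (cases "y \<in> K")
          case False
          then obtain i where "i < mdim M" "\<epsilon> < \<bar>\<phi> y i - \<phi> x i\<bar>"
            using y sub unfolding K_def by (auto simp: not_le)
          then have "\<exists>i\<in>{..<mdim M}. w i y = 0"
            using wpos by (auto intro!: bexI[of _ i])
          then show ?thesis
            using False by (simp add: \<rho>_def)
        qed (simp add: \<rho>_def)
      qed
      then show ?thesis
        using o True K(2) by (intro exI[of _ "U \<inter> W"]) auto
    next
      case False
      have "\<rho> \<in> smooth_funs_on M (- K)"
        using K(1) by (intro smooth_funs_on_cong[OF _ smooth_funs_on_const[of _ 0]]) (auto simp: \<rho>_def)
      then show ?thesis
        using False K(1) by (intro exI[of _ "- K"]) auto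
    qed
  qed
  moreover have "\<rho> x \<noteq> 0"
  proof -
    have "x \<in> K"
      using c(2) assms(2) sub \<epsilon>(1) by (auto simp: K_def)
    then show ?thesis
      using wpos \<epsilon>(1) by (simp add: \<rho>_def not_le)
  qed
  ultimately show ?thesis
    using that K by (auto simp: \<rho>_def)
qed

text \<open>The open sets \<open>W\<close> and \<open>- K\<close> cover the manifold; the function
  is a smooth product over the first and zero over the second.\<close>

lemma smooth_funs_on_extend_by_zero:
  assumes "open V" "open W" "closed K" "K \<subseteq> W" "\<rho> \<in> smooth_funs M" "\<And>y. y \<notin> K \<Longrightarrow> \<rho> y = 0"
    and "f \<in> smooth_funs_on M (V \<inter> W)"
  shows "(\<lambda>y. if y \<in> W then \<rho> y * f y else 0) \<in> smooth_funs_on M V"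
proof (rule smooth_funs_on_local[OF assms(1)])
  fix z assume "z \<in> V"
  let ?f = "\<lambda>y. if y \<in> W then \<rho> y * f y else 0"
  show "\<exists>T. open T \<and> z \<in> T \<and> ?f \<in> smooth_funs_on M (V \<inter> T)"
  proof (cases "z \<in> K")
    case True
    have o: "open (V \<inter> W)" using assms by blast
    have "\<rho> * f \<in> smooth_funs_on M (V \<inter> W)"
      using assms(5,7) by (intro smooth_funs_on_mult o) (auto intro: smooth_funs_on_subset)
    then have "?f \<in> smooth_funs_on M (V \<inter> W)"
      by (rule smooth_funs_on_cong[OF o]) auto
    then show ?thesis
      using True assms(2,4) by (intro exI[of _ W]) auto
  next
    case False
    have "?f \<in> smooth_funs_on M (V \<inter> - K)"
      using assms(1,3,6) by (intro smooth_funs_on_cong[OF _ smooth_funs_on_const[of _ 0]]) auto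
    then show ?thesis
      using False assms(3) by (intro exI[of _ "- K"]) auto
  qed
qed

text \<open>Smoothness in each chart is checked with the frame of that same chart, so that no change of
  coordinates in the partial derivatives is needed.\<close>

lemma vector_field_deriv_smooth:
  assumes "X \<in> \<Gamma> M (tangent_bundle M)" "f \<in> smooth_funs M"
  shows "X \<rhd> f \<in> smooth_funs M"
  unfolding smooth_funs_on_def
proof clarify
  fix U \<phi> assume c: "(U, \<phi>) \<in> atlas M"
  let ?E = "Euclidean_space (mdim M)"
  have o: "openin ?E (\<phi> ` (U \<inter> UNIV))"
    using chart_openin[OF c] by blast
  have "smooth_comb M (mdim M) U (coord_field M U \<phi>) X"
    using assms(1) c by (force simp: sections_def tangent_bundle_def)
  then obtain k where k: "\<And>i. i < mdim M \<Longrightarrow> k i \<in> smooth_funs_on M U"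
    "\<And>x. x \<in> U \<Longrightarrow> X x = (\<Sum>i<mdim M. k i x *\<^sub>R coord_field M U \<phi> i x)"
    by (auto simp: smooth_comb_def)
  show "smooth_on (mdim M) (\<phi> ` (U \<inter> UNIV)) ((X \<rhd> f) \<circ> inv_into U \<phi>)"
  proof (rule smooth_on_cong[OF o])
    show "smooth_on (mdim M) (\<phi> ` (U \<inter> UNIV))
      (\<lambda>p. \<Sum>i\<in>{..<mdim M}. k i (inv_into U \<phi> p) * partial_deriv i (f \<circ> inv_into U \<phi>) p)"
    proof (intro smooth_on_sum smooth_on_mult smooth_on_partial_deriv o)
      fix i assume "i \<in> {..<mdim M}"
      then show "smooth_on (mdim M) (\<phi> ` (U \<inter> UNIV)) (\<lambda>p. k i (inv_into U \<phi> p))"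
        using smooth_funs_onD[OF k(1) c] by simp
    next
      show "smooth_on (mdim M) (\<phi> ` (U \<inter> UNIV)) (f \<circ> inv_into U \<phi>)"
        using assms(2) c unfolding smooth_funs_on_def by auto
    qed auto
  next
    fix p assume "p \<in> \<phi> ` (U \<inter> UNIV)"
    then obtain x where "x \<in> U" "p = \<phi> x" by blast
    then show "(\<Sum>i\<in>{..<mdim M}. k i (inv_into U \<phi> p) * partial_deriv i (f \<circ> inv_into U \<phi>) p) =
        ((X \<rhd> f) \<circ> inv_into U \<phi>) p"
      using chart_inj[OF c] assms(2) by (simp add: k(2) sum_fun_apply coord_field_def)
  qed
qed

section \<open>Sections of a vector bundle\<close>

context
  fixes A :: "('m, 'v::real_vector) vbundle"
  assumes A: "vector_bundle M A"
begin

lemma frame_open: "(U, e) \<in> frames A \<Longrightarrow> open U"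
  using A by (auto simp: vector_bundle_def)

lemma subspace_fib: "subspace (fib A x)"
  using A by (simp add: vector_bundle_def)

lemma section_coefficients:
  assumes "s \<in> \<Gamma> M A" "(U, e) \<in> frames A"
  obtains k where "\<forall>i<vrank A. k i \<in> smooth_funs_on M U"
    "\<forall>x\<in>U. s x = (\<Sum>i<vrank A. k i x *\<^sub>R e i x)"
proof -
  have "smooth_comb M (vrank A) U e s"
    using assms by (auto simp: sections_def)
  then show ?thesis
    unfolding smooth_comb_def by (elim exE conjE) (rule that)
qed

lemma sections_add:
  assumes "s \<in> \<Gamma> M A" "t \<in> \<Gamma> M A"
  shows "s + t \<in> \<Gamma> M A"
proof -
  have "smooth_comb M (vrank A) U e (s + t)" if e: "(U, e) \<in> frames A" for U e
  proof -
    obtain k where k: "\<forall>i<vrank A. k i \<in> smooth_funs_on M U"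
        "\<forall>x\<in>U. s x = (\<Sum>i<vrank A. k i x *\<^sub>R e i x)"
      by (rule section_coefficients[OF assms(1) e])
    obtain l where l: "\<forall>i<vrank A. l i \<in> smooth_funs_on M U"
        "\<forall>x\<in>U. t x = (\<Sum>i<vrank A. l i x *\<^sub>R e i x)"
      by (rule section_coefficients[OF assms(2) e])
    show ?thesis
      unfolding smooth_comb_def using k l
      by (intro exI[of _ "\<lambda>i. k i + l i"])
        (auto intro!: smooth_funs_on_add frame_open[OF e] simp: scaleR_left_distrib sum.distrib)
  qed
  moreover have "(s + t) x \<in> fib A x" for x
    using assms subspace_fib[of x] by (simp add: sections_def subspace_add)
  ultimately show ?thesis
    by (auto simp: sections_def)
qed

lemma sections_scale:
  assumes "f \<in> smooth_funs M" "s \<in> \<Gamma> M A"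
  shows "f \<cdot> s \<in> \<Gamma> M A"
proof -
  have "smooth_comb M (vrank A) U e (f \<cdot> s)" if e: "(U, e) \<in> frames A" for U e
  proof -
    obtain k where k: "\<forall>i<vrank A. k i \<in> smooth_funs_on M U"
        "\<forall>x\<in>U. s x = (\<Sum>i<vrank A. k i x *\<^sub>R e i x)"
      by (rule section_coefficients[OF assms(2) e])
    show ?thesis
      unfolding smooth_comb_def using k assms(1)
      by (intro exI[of _ "\<lambda>i. f * k i"])
        (auto intro!: smooth_funs_on_mult frame_open[OF e] intro: smooth_funs_on_subset
          simp: scaleR_sum_right)
  qed
  moreover have "(f \<cdot> s) x \<in> fib A x" for x
    using assms subspace_fib[of x] by (simp add: sections_def subspace_scale)
  ultimately show ?thesis
    by (auto simp: sections_def)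
qed

text \<open>A bump function times the first member of a local frame, extended by zero. The nonzero
  \<open>s\<close> excludes rank zero, where the zero section is the only one.\<close>

lemma nonvanishing_section:
  assumes "s \<in> \<Gamma> M A" "s \<noteq> 0"
  shows "\<exists>t\<in>\<Gamma> M A. t x \<noteq> 0"
proof -
  have frame: "independent ((\<lambda>i. e i y) ` {..<vrank A}) \<and> span ((\<lambda>i. e i y) ` {..<vrank A}) = fib A y"
    if "(W, e) \<in> frames A" "y \<in> W" for W e y
  proof -
    have "\<forall>(U, e)\<in>frames A. open U \<and>
       (\<forall>x\<in>U. inj_on (\<lambda>i. e i x) {..<vrank A} \<and> independent ((\<lambda>i. e i x) ` {..<vrank A}) \<and>
              span ((\<lambda>i. e i x) ` {..<vrank A}) = fib A x)"
      using A unfolding vector_bundle_def by (elim conjE)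
    from bspec[OF this that(1)] that(2) show ?thesis
      unfolding prod.case by blast
  qed
  have cover: "\<exists>W e. (W, e) \<in> frames A \<and> y \<in> W" for y
  proof -
    have "(\<Union>(U, e)\<in>frames A. U) = UNIV"
      using A unfolding vector_bundle_def by (elim conjE)
    then have "y \<in> (\<Union>(U, e)\<in>frames A. U)"
      by simp
    then show ?thesis by auto
  qed
  have rank: "0 < vrank A"
  proof (rule ccontr)
    assume "\<not> 0 < vrank A"
    then have "vrank A = 0" by simp
    then have "fib A y = {0}" for y
      using cover[of y] frame[of _ _ y] by auto
    then have "s = 0"
      using assms(1) by (auto simp: sections_def fun_eq_iff)
    with assms(2) show False by simp
  qed
  obtain W e where e: "(W, e) \<in> frames A" "x \<in> W"
    using cover by blast
  obtain \<rho> K where \<rho>: "\<rho> \<in> smooth_funs M" "closed K" "K \<subseteq> W" "\<rho> x \<noteq> 0" "\<And>y. y \<notin> K \<Longrightarrow> \<rho> y = 0"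
    using bump_function[OF frame_open[OF e(1)] e(2)] by metis
  define t where "t y = (if y \<in> W then \<rho> y *\<^sub>R e 0 y else 0)" for y
  have "t \<in> \<Gamma> M A"
    unfolding sections_def
  proof (clarify, intro conjI allI ballI, safe)
    fix y
    note subspace_fib[of y]
    moreover have "e 0 y \<in> fib A y" if "y \<in> W"
      using frame[OF e(1) that] rank span_base[of "e 0 y" "(\<lambda>i. e i y) ` {..<vrank A}"] by auto
    ultimately show "t y \<in> fib A y"
      by (auto simp: t_def intro: subspace_scale subspace_0)
  next
    fix V e' assume e': "(V, e') \<in> frames A"
    have "\<forall>(U, e)\<in>frames A. \<forall>(V, e')\<in>frames A. \<forall>j<vrank A.
        smooth_comb M (vrank A) (U \<inter> V) e (e' j)"
      using A unfolding vector_bundle_def by (elim conjE)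
    \<comment> \<open>In another frame the coefficients of \<open>e 0\<close> are smooth only on the
      overlap; the factor \<open>\<rho>\<close> lets them be extended by zero to all of
      \<open>V\<close>.\<close>
    from bspec[OF this e'] have "smooth_comb M (vrank A) (V \<inter> W) e' (e 0)"
      using e(1) rank by auto
    then obtain k where k: "\<forall>i<vrank A. k i \<in> smooth_funs_on M (V \<inter> W)"
        "\<forall>x\<in>V \<inter> W. e 0 x = (\<Sum>i<vrank A. k i x *\<^sub>R e' i x)"
      unfolding smooth_comb_def by blast
    show "smooth_comb M (vrank A) V e' t"
      unfolding smooth_comb_def
    proof (intro exI conjI allI impI ballI)
      show "(\<lambda>y. if y \<in> W then \<rho> y * k i y else 0) \<in> smooth_funs_on M V" if "i < vrank A" for i
        using k(1) that frame_open e(1) e' \<rho> by (intro smooth_funs_on_extend_by_zero) auto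
      show "t y = (\<Sum>i<vrank A. (if y \<in> W then \<rho> y * k i y else 0) *\<^sub>R e' i y)" if "y \<in> V" for y
        using k(2) that by (auto simp: t_def scaleR_sum_right)
    qed
  qed
  moreover have "t x \<noteq> 0"
  proof -
    let ?S = "(\<lambda>i. e i x) ` {..<vrank A}"
    have "e 0 x \<in> ?S"
      using rank by (intro image_eqI[of _ _ 0]) auto
    moreover have "0 \<notin> ?S"
      using frame[OF e] dependent_zero[of ?S] by blast
    ultimately have "e 0 x \<noteq> 0"
      by metis
    then show ?thesis
      using e(2) \<rho>(4) by (simp add: t_def)
  qed
  ultimately show ?thesis by blast
qed

end

end

section \<open>Fibrewise linearity of the squiggle\<close>

lemma tangent_space_add: "v \<in> tangent_space M x \<Longrightarrow> w \<in> tangent_space M x \<Longrightarrow> v + w \<in> tangent_space M x"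
  by (simp add: tangent_space_def algebra_simps)

lemma tangent_space_scaleR: "v \<in> tangent_space M x \<Longrightarrow> r *\<^sub>R v \<in> tangent_space M x"
  by (simp add: tangent_space_def algebra_simps)

lemma differential_tensor_fibre:
  assumes "subspace (fib A x)" "a x \<in> fib A x"
  shows "(differential M f \<otimes> a) x \<in> fib (cotangent_tensor M A) x"
  using assms
  by (auto simp: tensor_def differential_def cotangent_tensor_def hom_bundle_def tangent_bundle_def
      hom_fib_def tangent_space_add tangent_space_scaleR scaleR_left_distrib subspace_scale subspace_0)

text \<open>Members of \<open>hom_fib\<close> are linear on the fibre and zero off it, so both
  summands have to lie in the fibre at each point.\<close>

lemma on_sections_add:
  assumes "\<sigma> \<in> \<Gamma> M (hom_bundle B C)" "\<And>x. s x \<in> fib B x" "\<And>x. t x \<in> fib B x"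
  shows "on_sections \<sigma> (s + t) = on_sections \<sigma> s + on_sections \<sigma> t"
  using assms by (auto simp: sections_def hom_bundle_def hom_fib_def on_sections_def fun_eq_iff)


(* The right-hand side of the last identity carries a minus sign. Without it the identity fails:
   take the trivial line bundle on the plane with the Poisson bracket, a = c = 1, f = g = x,
   b = h = y; then the left-hand side is 1 and the sum in parentheses is -1. *)
theorem proposition3p1p2:
  fixes M :: "'m::{t2_space,second_countable_topology} smooth_structure"
    and A :: "('m, 'v::real_vector) vbundle"
    and br :: "('m \<Rightarrow> 'v) \<Rightarrow> ('m \<Rightarrow> 'v) \<Rightarrow> 'm \<Rightarrow> 'v"
    and lam :: "('m \<Rightarrow> 'v) \<Rightarrow> 'm \<Rightarrow> 'm tvec"
    and \<Lambda> :: "('m \<Rightarrow> 'm tvec \<Rightarrow> 'v) \<Rightarrow> 'm \<Rightarrow> 'm tvec"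
    and a b c :: "'m \<Rightarrow> 'v"
    and f g h :: "'m \<Rightarrow> real"
  assumes "smooth_manifold M"
    and "vector_bundle M A"
    and "derivative_lie_algebra M A br lam"
    and "is_squiggle M A lam \<Lambda>"
    and "a \<in> \<Gamma> M A" "b \<in> \<Gamma> M A" "c \<in> \<Gamma> M A"
    and "f \<in> smooth_funs M" "g \<in> smooth_funs M" "h \<in> smooth_funs M"
  shows "lam (f \<cdot> a) = f \<cdot> lam a + \<Lambda> (differential M f \<otimes> a) \<and>
    (\<Lambda> (differential M f \<otimes> a) \<rhd> g) \<cdot> b = - ((\<Lambda> (differential M g \<otimes> b) \<rhd> f) \<cdot> a) \<and>
    lam (br a b) = vf_bracket (lam a) (lam b) \<and>
    vf_bracket (lam a) (\<Lambda> (differential M f \<otimes> b)) =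
      \<Lambda> (differential M (lam a \<rhd> f) \<otimes> b + differential M f \<otimes> br a b) \<and>
    (\<Lambda> (differential M f \<otimes> a) \<rhd> (\<Lambda> (differential M g \<otimes> b) \<rhd> h)) \<cdot> c +
    (\<Lambda> (differential M g \<otimes> b) \<rhd> (\<Lambda> (differential M h \<otimes> c) \<rhd> f)) \<cdot> a +
    (\<Lambda> (differential M h \<otimes> c) \<rhd> (\<Lambda> (differential M f \<otimes> a) \<rhd> g)) \<cdot> b =
    - (((lam b \<rhd> f) * (\<Lambda> (differential M g \<otimes> a) \<rhd> h)) \<cdot> c +
       ((lam c \<rhd> g) * (\<Lambda> (differential M h \<otimes> b) \<rhd> f)) \<cdot> a +
       ((lam a \<rhd> h) * (\<Lambda> (differential M f \<otimes> c) \<rhd> g)) \<cdot> b)"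
proof -
  have lie: "lie_bracket_on (\<Gamma> M A) br"
    and op: "diff_op M A (tangent_bundle M) lam"
    and leib: "\<And>a b f. a \<in> \<Gamma> M A \<Longrightarrow> b \<in> \<Gamma> M A \<Longrightarrow> f \<in> smooth_funs M \<Longrightarrow>
       br a (f \<cdot> b) = f \<cdot> br a b + (lam a \<rhd> f) \<cdot> b"
    using assms(3) by (simp_all add: derivative_lie_algebra_def)
  have lam: "lam a \<in> \<Gamma> M (tangent_bundle M)" if "a \<in> \<Gamma> M A" for a
    using op that by (simp add: diff_op_def)
  then have ts: "lam a x \<in> tangent_space M x" if "a \<in> \<Gamma> M A" for a x
    using that by (fastforce simp: sections_def tangent_bundle_def)
  \<comment> \<open>Here \<open>lam_outside\<close> rests on the convention that tangent vectors are
    zero on non-smooth arguments.\<close>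
  interpret derivation_bracket "smooth_funs M" "\<Gamma> M A" br lam
  proof
    fix a b f g r x
    show "\<lbrakk>f \<in> smooth_funs M; g \<in> smooth_funs M\<rbrakk> \<Longrightarrow> f + g \<in> smooth_funs M"
      by (simp add: smooth_funs_on_add assms(1))
    show "\<lbrakk>f \<in> smooth_funs M; g \<in> smooth_funs M\<rbrakk> \<Longrightarrow> f * g \<in> smooth_funs M"
      by (simp add: smooth_funs_on_mult assms(1))
    show "f \<in> smooth_funs M \<Longrightarrow> r *\<^sub>R f \<in> smooth_funs M"
      by (simp add: smooth_funs_on_scaleR assms(1))
    show "\<lbrakk>a \<in> \<Gamma> M A; b \<in> \<Gamma> M A\<rbrakk> \<Longrightarrow> a + b \<in> \<Gamma> M A"
      by (rule sections_add[OF assms(1,2)])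
    show "\<lbrakk>f \<in> smooth_funs M; a \<in> \<Gamma> M A\<rbrakk> \<Longrightarrow> f \<cdot> a \<in> \<Gamma> M A"
      by (rule sections_scale[OF assms(1,2)])
    show "lie_bracket_on (\<Gamma> M A) br" by (rule lie)
    show "\<lbrakk>a \<in> \<Gamma> M A; b \<in> \<Gamma> M A; f \<in> smooth_funs M\<rbrakk> \<Longrightarrow> br a (f \<cdot> b) = f \<cdot> br a b + (lam a \<rhd> f) \<cdot> b"
      by (rule leib)
    show "\<lbrakk>a \<in> \<Gamma> M A; f \<in> smooth_funs M\<rbrakk> \<Longrightarrow> lam a \<rhd> f \<in> smooth_funs M"
      by (rule vector_field_deriv_smooth[OF assms(1) lam])
    show "\<lbrakk>a \<in> \<Gamma> M A; f \<in> smooth_funs M; g \<in> smooth_funs M\<rbrakk> \<Longrightarrow> lam a \<rhd> (f + g) = lam a \<rhd> f + lam a \<rhd> g"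
      using ts by (simp add: tangent_space_def fun_eq_iff)
    show "\<lbrakk>a \<in> \<Gamma> M A; f \<in> smooth_funs M\<rbrakk> \<Longrightarrow> lam a \<rhd> (r *\<^sub>R f) = r *\<^sub>R (lam a \<rhd> f)"
      using ts by (simp add: tangent_space_def fun_eq_iff)
    show "\<lbrakk>a \<in> \<Gamma> M A; f \<in> smooth_funs M; g \<in> smooth_funs M\<rbrakk> \<Longrightarrow>
        lam a \<rhd> (f * g) = f * (lam a \<rhd> g) + g * (lam a \<rhd> f)"
      using ts by (simp add: tangent_space_def fun_eq_iff)
    show "\<lbrakk>a \<in> \<Gamma> M A; f \<notin> smooth_funs M\<rbrakk> \<Longrightarrow> lam a \<rhd> f = 0"
      using ts by (simp add: tangent_space_def fun_eq_iff)
    show "\<lbrakk>a \<in> \<Gamma> M A; b \<in> \<Gamma> M A\<rbrakk> \<Longrightarrow> lam (a + b) = lam a + lam b"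
      using op by (simp add: diff_op_def)
    show "\<lbrakk>f \<in> smooth_funs M; g \<in> smooth_funs M; a \<in> \<Gamma> M A\<rbrakk> \<Longrightarrow>
        mult_commutator (mult_commutator lam f) g a = 0"
      using op by (simp add: diff_op_def)
    show "\<lbrakk>a \<in> \<Gamma> M A; a \<noteq> 0\<rbrakk> \<Longrightarrow> \<exists>c\<in>\<Gamma> M A. c x \<noteq> 0"
      by (rule nonvanishing_section[OF assms(1,2)])
  qed
  obtain \<sigma> where \<sigma>: "is_symbol M A (tangent_bundle M) lam \<sigma>" "\<Lambda> = on_sections \<sigma>"
    using assms(4) unfolding is_squiggle_def by blast
  \<comment> \<open>The defining equation of the symbol identifies the squiggle on
    \<open>df \<otimes> a\<close> with the commutator \<open>squig f a\<close>.\<close>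
  have \<Lambda>: "\<Lambda> (differential M f \<otimes> a) = squig f a" if "f \<in> smooth_funs M" "a \<in> \<Gamma> M A" for f a
    using \<sigma> that by (simp add: is_symbol_def squig_def mult_commutator_def)
  have fibre: "(differential M f \<otimes> a) x \<in> fib (cotangent_tensor M A) x" if "a \<in> \<Gamma> M A" for f a x
    using assms(2) that by (intro differential_tensor_fibre) (auto simp: vector_bundle_def sections_def)
  \<comment> \<open>The fourth identity applies the squiggle to a sum of two elementary tensors, so
    additivity of \<open>\<sigma>\<close> on the fibres is required.\<close>
  have add: "\<Lambda> (differential M p \<otimes> d + differential M q \<otimes> e) = squig p d + squig q e"
    if "p \<in> smooth_funs M" "d \<in> \<Gamma> M A" "q \<in> smooth_funs M" "e \<in> \<Gamma> M A" for p q d e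
    using \<sigma> that on_sections_add[of \<sigma> M "cotangent_tensor M A" "tangent_bundle M"
        "differential M p \<otimes> d" "differential M q \<otimes> e"]
    by (simp add: is_symbol_def fibre \<Lambda>[unfolded \<sigma>(2)])
  show ?thesis
    using assms(5-10)
    by (simp only: \<Lambda> add lam_closed br_closed)
      (intro conjI lam_scale squig_swap lam_br vf_bracket_lam_squig squig_cyclic)
qed

end
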